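(* For the recursively defined rectangle families $P_r$, both of the following limits exist and $$\lim_{r\to\infty}\frac{\alpha^*(P_r)}{\nu(P_r)}=\lim_{r\to\infty}\frac{\tau(P_r)}{\nu(P_r)}=\frac52 .$$
   Context: All rectangles are closed and axis-parallel. For a finite rectangle family $\mathcal R$, $\nu(\mathcal R)$ is the maximum size of a pairwise disjoint subfamily, $\tau(\mathcal R)$ is the minimum number of points of the plane such that every rectangle of $\mathcal R$ contains at least one of them, and $G(\mathcal R)$ is the intersection graph (vertices are the rectangles, edges join intersecting pairs). The clique relaxation value is $$\alpha^*(\mathcal R)=\alpha^*(G(\mathcal R))=\max\Big\{\sum_{v}x_v:\ x_v\ge 0,\ \sum_{v\in K}x_v\le 1\text{ for every clique }K\text{ of }G(\mathcal R)\Big\}.$$ Construction of $P_r$. Write $[q]=\{0,1,\dots,q-1\}$. Each $P_r$ is a finite rectangle family drawn in a square $[0,L]^2$ together with $q$ vertical marker lines $x=\xi_0,\dots,x=\xi_{q-1}$ and $q$ horizontal marker lines $y=\eta_0,\dots,y=\eta_{q-1}$ (in increasing order). Base: $P_0$ has $L=30$, $q=4$, $\xi=(3,11,19,27)$, $\eta=(3,11,21,27)$ and consists of the eight rectangles $T=[0,30]\times[26,28]$, $U_L=[0,16]\times[20,22]$, $U_R=[14,30]\times[20,22]$, $C_0=[0,8]\times[2,10]$, $C_1=[6,16]\times[8,14]$, $C_2=[14,24]\times[8,14]$, $C_3=[22,30]\times[2,12]$, $Q=[6,24]\times[0,4]$. Crossbar step: given $P$ with data $L,q,\xi,\eta$,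 put $M=L+1$, and for $R=[x_1,x_2]\times[y_1,y_2]\in P$ and $i,j\in[q]$ let $$H_i(R)=[Mx_1,Mx_2]\times[M\xi_i+y_1,M\xi_i+y_2],\qquad V_j(R)=[M\xi_j+y_1,M\xi_j+y_2]\times[Mx_1,Mx_2].$$ $C(P)$ is the family of all $H_i(R)$ and $V_j(R)$ with $R\in P$, $i,j\in[q]$. It is drawn in $[0,ML+L]^2$, with $q^2$ vertical markers $\xi'_{(j,t)}=M\xi_j+\eta_t$ and $q^2$ horizontal markers $\eta'_{(i,t)}=M\xi_i+\eta_t$, indexed by $[q]\times[q]$ and ordered lexicographically. Recursion: $P_{r+1}=C(P_r)$ for $r\ge0$. *)

theory Defs
  imports "HOL-Analysis.Analysis" "HOL-Library.Ramsey" "HOL-Library.Disjoint_Sets"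
begin

text \<open>\<open>Rect a b c d\<close> stands for the closed rectangle \<open>[a, b] \<times> [c, d]\<close>. All rectangles
  constructed below are nondegenerate, so distinct quadruples are distinct point sets.\<close>

datatype rect = Rect (xmin: real) (xmax: real) (ymin: real) (ymax: real)

definition region :: "rect \<Rightarrow> (real \<times> real) set" where
  "region R = {xmin R..xmax R} \<times> {ymin R..ymax R}"

definition packing_number :: "rect set \<Rightarrow> nat" where
  "packing_number F = Max {card S | S. S \<subseteq> F \<and> disjoint_family_on region S}"

definition piercing_number :: "rect set \<Rightarrow> nat" where
  "piercing_number F =
     (LEAST n. \<exists>X. finite X \<and> card X = n \<and> (\<forall>R\<in>F. region R \<inter> X \<noteq> {}))"

definition intersection_edges :: "rect set \<Rightarrow> rect set set" where
  "intersection_edges F =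
     {{R, S} | R S. R \<in> F \<and> S \<in> F \<and> R \<noteq> S \<and> region R \<inter> region S \<noteq> {}}"

text \<open>For finite \<open>V\<close> the feasible polytope is nonempty and compact (singletons are cliques),
  so the supremum is a maximum.\<close>

definition clique_relaxation :: "'v set \<Rightarrow> 'v set set \<Rightarrow> real" where
  "clique_relaxation V E =
     Sup {\<Sum>v\<in>V. x v | x :: 'v \<Rightarrow> real.
            (\<forall>v\<in>V. 0 \<le> x v) \<and> (\<forall>K. K \<subseteq> V \<and> clique K E \<longrightarrow> (\<Sum>v\<in>K. x v) \<le> 1)}"

definition alpha_star :: "rect set \<Rightarrow> real" where
  "alpha_star F = clique_relaxation F (intersection_edges F)"

text \<open>A family drawn in \<open>[0, side]\<^sup>2\<close> with vertical marker lines \<open>x = xi i\<close> and horizontal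
  marker lines \<open>y = eta i\<close>; only the values at \<open>i < num\<close> are meaningful.\<close>

record drawing =
  rects :: "rect set"
  side :: real
  num :: nat
  xi :: "nat \<Rightarrow> real"
  eta :: "nat \<Rightarrow> real"

definition base_drawing :: drawing where
  "base_drawing = \<lparr>
     rects =
      {Rect 0 30 26 28,
       Rect 0 16 20 22, Rect 14 30 20 22,
       Rect 0 8 2 10, Rect 6 16 8 14, Rect 14 24 8 14, Rect 22 30 2 12,
       Rect 6 24 0 4},
     side = 30,
     num = 4,
     xi = (\<lambda>i. [3, 11, 19, 27] ! i),
     eta = (\<lambda>i. [3, 11, 21, 27] ! i)\<rparr>"

definition horizontal_copy :: "drawing \<Rightarrow> nat \<Rightarrow> rect \<Rightarrow> rect" where
  "horizontal_copy P i R =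
     (let M = side P + 1
      in Rect (M * xmin R) (M * xmax R) (M * xi P i + ymin R) (M * xi P i + ymax R))"

definition vertical_copy :: "drawing \<Rightarrow> nat \<Rightarrow> rect \<Rightarrow> rect" where
  "vertical_copy P j R =
     (let M = side P + 1
      in Rect (M * xi P j + ymin R) (M * xi P j + ymax R) (M * xmin R) (M * xmax R))"

text \<open>A pair \<open>(j, t)\<close> in \<open>[q] \<times> [q]\<close> has lexicographic position \<open>k = j * q + t\<close>, i.e.
  \<open>j = k div q\<close> and \<open>t = k mod q\<close>. Both new marker sequences are built from the old
  vertical positions \<open>xi\<close> shifted by the old horizontal ones \<open>eta\<close>, so they coincide.\<close>

definition crossbar :: "drawing \<Rightarrow> drawing" where
  "crossbar P =
     (let M = side P + 1; q = num P in \<lparr>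
        rects = {horizontal_copy P i R | i R. i < q \<and> R \<in> rects P}
              \<union> {vertical_copy P j R | j R. j < q \<and> R \<in> rects P},
        side = M * side P + side P,
        num = q * q,
        xi = (\<lambda>k. M * xi P (k div q) + eta P (k mod q)),
        eta = (\<lambda>k. M * xi P (k div q) + eta P (k mod q))\<rparr>)"

definition drawing_seq :: "nat \<Rightarrow> drawing" where
  "drawing_seq r = (crossbar ^^ r) base_drawing"

definition rect_family :: "nat \<Rightarrow> rect set" where
  "rect_family r = rects (drawing_seq r)"

end

theory Submission
  imports Defs
begin

text \<open>Write \<open>q = 4 ^ 2 ^ r\<close> for the number of vertical (equally, horizontal) markers of \<open>P\<^sub>r\<close>.
  Everything rests on one crossing law: the bars \<open>H\<^sub>i(R)\<close> and \<open>V\<^sub>j(S)\<close> meet exactly when the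
  \<open>j\<close>-th vertical marker crosses \<open>R\<close> and the \<open>i\<close>-th vertical marker crosses \<open>S\<close>
  (\<open>meets_horizontal_vertical\<close>), while bars of the same direction meet only if they are
  copies with the same index of meeting rectangles. The markers of the new drawing cross
  the bars by similar rules, so that the quantities below can be followed through the
  recursion.

  \<^bold>\<open>The packing number is \<open>q\<close>.\<close> A packing has at most as many members as there are vertical
  markers crossing it, and likewise for horizontal ones. This is inherited by the crossbar
  step: for a pair \<open>(i, j)\<close> the crossing law forbids that \<open>j\<close> is used by the packing in
  the \<open>i\<close>-th horizontal bar system and, at the same time, \<open>i\<close> by the one in the \<open>j\<close>-th
  vertical system, so the pairs can be charged only once (\<open>trace_bounded_crossbar\<close>).

  \<^bold>\<open>The piercing number is at most \<open>5 / 2 * q\<close>.\<close> All points are taken at crossings of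
  markers. The crossing of the vertical marker \<open>(j, t)\<close> with the horizontal marker \<open>(i,
  s)\<close> acts in \<open>H\<^sub>i\<close> like the crossing \<open>(j, s)\<close> of the old drawing and in \<open>V\<^sub>j\<close> like the
  crossing \<open>(i, t)\<close>. Hence one new point does the work of two old ones, provided that the
  piercing sets of \<open>H\<^sub>i\<close> and \<open>V\<^sub>j\<close> use the same number of points on the markers \<open>j\<close> and \<open>i\<close>.
  Ten points pierce the base drawing with prescribed numbers of points, 3 or 2, on each of
  its four vertical and four horizontal markers; prescribing these numbers along a
  symmetric matrix makes the systems compatible, and the average of \<open>5 / 2\<close> per marker is
  preserved (\<open>covering_weights_crossbar\<close>).

  \<^bold>\<open>The clique relaxation is at least \<open>(5 / 2 - o(1)) * q\<close>.\<close> Points give cliques, so the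
  clique relaxation lies below the piercing number and only a fractional packing is
  missing. On average five of the ten points lie on the two lowest horizontal markers,
  which cross just the five rectangles of the cycle \<open>C\<^sub>0, C\<^sub>1, C\<^sub>2, C\<^sub>3, Q\<close>, while the other
  rectangles have points to spare. So only the \<open>5 / 4 * 2 ^ r * q\<close> bars descending from
  the cycle get weight. A marker crossing corresponds to \<open>2 ^ r\<close> crossings in copies of
  the base drawing and hits the cycle only in those on the two lowest horizontal markers.
  That is half of them on average, and by Chebyshev's inequality hardly more than half for
  almost all markers, the light ones (\<open>card_light_markers\<close>). If from some level on only
  bars with light indices are kept, few bars are lost, yet each clique crossed by light
  markers in both directions has size at most about \<open>2 ^ r / 2\<close>, and after several thinned
  steps this bound governs all cliques (\<open>iterated_thinning\<close>). Uniform weights on the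
  remaining bars then have total \<open>(5 / 4 * 2 ^ r * q) / (2 ^ r / 2)\<close> in the limit.\<close>

section \<open>Geometry of the crossbar step\<close>

lemma all_less_4: "(\<forall>k<4::nat. Q k) \<longleftrightarrow> Q 0 \<and> Q 1 \<and> Q 2 \<and> Q 3"
  by (auto simp: numeral_eq_Suc less_Suc_eq)

lemma sum_less_4: "(\<Sum>k<4::nat. f k) = (f 0 + f 1 + f 2 + f 3 :: 'a::comm_monoid_add)"
  by (simp add: numeral_eq_Suc lessThan_Suc ac_simps)

definition meets :: "rect \<Rightarrow> rect \<Rightarrow> bool" where
  "meets R S \<longleftrightarrow> region R \<inter> region S \<noteq> {}"

definition on_xi :: "drawing \<Rightarrow> nat \<Rightarrow> rect \<Rightarrow> bool" where
  "on_xi P k R \<longleftrightarrow> xmin R \<le> xi P k \<and> xi P k \<le> xmax R"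

definition on_eta :: "drawing \<Rightarrow> nat \<Rightarrow> rect \<Rightarrow> bool" where
  "on_eta P k R \<longleftrightarrow> ymin R \<le> eta P k \<and> eta P k \<le> ymax R"

text \<open>Integrality, together with markers that avoid the borders of all rectangles, lets the
  incidences in a crossbar be read off from the coordinates digit by digit. Proper
  rectangles are needed to tell horizontal bars from vertical ones.\<close>

definition integral_drawing :: "drawing \<Rightarrow> bool" where
  "integral_drawing P \<longleftrightarrow>
     finite (rects P) \<and> side P \<in> \<int> \<and> 0 \<le> side P \<and>
     (\<forall>R\<in>rects P. {xmin R, xmax R, ymin R, ymax R} \<subseteq> \<int> \<and>
        0 \<le> xmin R \<and> xmin R < xmax R \<and> xmax R \<le> side P \<and>
        0 \<le> ymin R \<and> ymin R < ymax R \<and> ymax R \<le> side P) \<and>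
     (\<forall>k<num P. {xi P k, eta P k} \<subseteq> \<int> \<and>
        0 < xi P k \<and> xi P k \<le> side P \<and> 0 < eta P k \<and> eta P k \<le> side P) \<and>
     inj_on (xi P) {..<num P} \<and> inj_on (eta P) {..<num P} \<and>
     (\<forall>R\<in>rects P. \<forall>k<num P. xi P k \<notin> {xmin R, xmax R} \<and> eta P k \<notin> {ymin R, ymax R})"

text \<open>Restricting the indices to \<open>G\<close> and the rectangles to \<open>A\<close> lets one operation describe the full
  crossbar, its subfamily over the five-cycle, and the thinned families of the lower bound.\<close>

definition bars :: "drawing \<Rightarrow> nat set \<Rightarrow> rect set \<Rightarrow> rect set" where
  "bars P G A = (\<Union>i\<in>G. horizontal_copy P i ` A \<union> vertical_copy P i ` A)"

lemma rects_crossbar: "rects (crossbar P) = bars P {..<num P} (rects P)"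
  by (auto simp: crossbar_def bars_def Let_def)

lemma num_crossbar [simp]: "num (crossbar P) = num P * num P"
  by (simp add: crossbar_def Let_def)

lemma side_crossbar: "side (crossbar P) = (side P + 1) * side P + side P"
  by (simp add: crossbar_def Let_def)

lemma xi_crossbar:
  "xi (crossbar P) k = (side P + 1) * xi P (k div num P) + eta P (k mod num P)"
  by (simp add: crossbar_def Let_def)

lemma eta_crossbar:
  "eta (crossbar P) k = (side P + 1) * xi P (k div num P) + eta P (k mod num P)"
  by (simp add: crossbar_def Let_def)

lemma copy_sel [simp]:
  "xmin (horizontal_copy P i R) = (side P + 1) * xmin R"
  "xmax (horizontal_copy P i R) = (side P + 1) * xmax R"
  "ymin (horizontal_copy P i R) = (side P + 1) * xi P i + ymin R"
  "ymax (horizontal_copy P i R) = (side P + 1) * xi P i + ymax R"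
  "xmin (vertical_copy P i R) = (side P + 1) * xi P i + ymin R"
  "xmax (vertical_copy P i R) = (side P + 1) * xi P i + ymax R"
  "ymin (vertical_copy P i R) = (side P + 1) * xmin R"
  "ymax (vertical_copy P i R) = (side P + 1) * xmax R"
  by (simp_all add: horizontal_copy_def vertical_copy_def Let_def)

lemma rect_eq_iff:
  "R = S \<longleftrightarrow> xmin R = xmin S \<and> xmax R = xmax S \<and> ymin R = ymin S \<and> ymax R = ymax S"
  by (cases R; cases S) auto

text \<open>All coordinates of a crossbar have the form \<open>(L + 1) * a + u\<close> with \<open>a\<close> an integer and
  \<open>0 \<le> u \<le> L\<close>, that is, two digits in base \<open>L + 1\<close>; they compare lexicographically.\<close>

lemma digits_less:
  fixes a b u v L :: real
  assumes "a \<in> \<int>" "b \<in> \<int>" "a < b" "0 \<le> u" "u \<le> L" "0 \<le> v" "v \<le> L"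
  shows "(L + 1) * a + u < (L + 1) * b + v"
proof -
  obtain m n where "a = of_int m" "b = of_int n"
    using assms(1,2) by (auto elim!: Ints_cases)
  then have "a + 1 \<le> b"
    using assms(3) by simp
  then have "(L + 1) * (a + 1) \<le> (L + 1) * b"
    using assms by (intro mult_left_mono) auto
  then show ?thesis using assms by (simp add: algebra_simps)
qed

lemma digits_le:
  fixes a b u v L :: real
  assumes "a \<in> \<int>" "b \<in> \<int>" "0 \<le> u" "u \<le> L" "0 \<le> v" "v \<le> L"
  shows "(L + 1) * a + u \<le> (L + 1) * b + v \<longleftrightarrow> a < b \<or> (a = b \<and> u \<le> v)"
  using digits_less[of a b u L v] digits_less[of b a v L u] assms
  by (cases a b rule: linorder_cases) auto

lemma digits_eq:
  fixes a b u v L :: real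
  assumes "a \<in> \<int>" "b \<in> \<int>" "0 \<le> u" "u \<le> L" "0 \<le> v" "v \<le> L"
  shows "(L + 1) * a + u = (L + 1) * b + v \<longleftrightarrow> a = b \<and> u = v"
  using digits_less[of a b u L v] digits_less[of b a v L u] assms
  by (cases a b rule: linorder_cases) auto

lemmas digits_le_0 =
  digits_le[where u = 0, simplified] digits_le[where v = 0, simplified]
lemmas digits_eq_0 =
  digits_eq[where u = 0, simplified] digits_eq[where v = 0, simplified]
  digits_eq[where u = 0 and v = 0, simplified]

lemma meets_iff:
  assumes "xmin R \<le> xmax R" "ymin R \<le> ymax R" "xmin S \<le> xmax S" "ymin S \<le> ymax S"
  shows "meets R S \<longleftrightarrow> xmin R \<le> xmax S \<and> xmin S \<le> xmax R \<and> ymin R \<le> ymax S \<and> ymin S \<le> ymax R"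
  using assms unfolding meets_def region_def Times_Int_Times Int_atLeastAtMost by auto

context
  fixes P assumes P: "integral_drawing P"
begin

lemma rect_bounds:
  assumes "R \<in> rects P"
  shows "xmin R \<in> \<int>" "xmax R \<in> \<int>" "ymin R \<in> \<int>" "ymax R \<in> \<int>"
    "0 \<le> xmin R" "xmin R < xmax R" "xmax R \<le> side P"
    "0 \<le> ymin R" "ymin R < ymax R" "ymax R \<le> side P"
    "xmin R \<le> side P" "0 \<le> xmax R" "ymin R \<le> side P" "0 \<le> ymax R"
    "xmin R \<le> xmax R" "ymin R \<le> ymax R"
proof -
  have *: "{xmin R, xmax R, ymin R, ymax R} \<subseteq> \<int> \<and>
        0 \<le> xmin R \<and> xmin R < xmax R \<and> xmax R \<le> side P \<and>
        0 \<le> ymin R \<and> ymin R < ymax R \<and> ymax R \<le> side P"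
    using P assms unfolding integral_drawing_def by blast
  show "xmin R \<in> \<int>" "xmax R \<in> \<int>" "ymin R \<in> \<int>" "ymax R \<in> \<int>"
    "0 \<le> xmin R" "xmin R < xmax R" "xmax R \<le> side P"
    "0 \<le> ymin R" "ymin R < ymax R" "ymax R \<le> side P"
    "xmin R \<le> side P" "0 \<le> xmax R" "ymin R \<le> side P" "0 \<le> ymax R"
    "xmin R \<le> xmax R" "ymin R \<le> ymax R"
    using * by auto
qed

lemma marker_bounds:
  assumes "k < num P"
  shows "xi P k \<in> \<int>" "eta P k \<in> \<int>" "0 < xi P k" "xi P k \<le> side P" "0 < eta P k" "eta P k \<le> side P"
    "0 \<le> xi P k" "0 \<le> eta P k"
  using P assms unfolding integral_drawing_def by (auto simp: less_imp_le)

lemma marker_avoids: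
  assumes "k < num P" "R \<in> rects P"
  shows "xi P k \<noteq> xmin R" "xi P k \<noteq> xmax R" "eta P k \<noteq> ymin R" "eta P k \<noteq> ymax R"
    "xmin R \<noteq> xi P k" "xmax R \<noteq> xi P k" "ymin R \<noteq> eta P k" "ymax R \<noteq> eta P k"
proof -
  have "xi P k \<notin> {xmin R, xmax R} \<and> eta P k \<notin> {ymin R, ymax R}"
    using P assms unfolding integral_drawing_def by blast
  then show "xi P k \<noteq> xmin R" "xi P k \<noteq> xmax R" "eta P k \<noteq> ymin R" "eta P k \<noteq> ymax R"
    "xmin R \<noteq> xi P k" "xmax R \<noteq> xi P k" "ymin R \<noteq> eta P k" "ymax R \<noteq> eta P k"
    by auto
qed

lemma xi_eq_iff: "i < num P \<Longrightarrow> j < num P \<Longrightarrow> xi P i = xi P j \<longleftrightarrow> i = j"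
  using P unfolding integral_drawing_def inj_on_def by auto

lemma eta_eq_iff: "i < num P \<Longrightarrow> j < num P \<Longrightarrow> eta P i = eta P j \<longleftrightarrow> i = j"
  using P unfolding integral_drawing_def inj_on_def by auto

lemma finite_rects: "finite (rects P)"
  using P unfolding integral_drawing_def by auto

lemma side_facts: "side P \<in> \<int>" "0 \<le> side P" "0 < side P + 1" "\<not> side P + 1 < 0" "side P + 1 \<noteq> 0"
  using P unfolding integral_drawing_def by auto

lemmas coordinate_facts = rect_bounds marker_bounds marker_avoids xi_eq_iff eta_eq_iff side_facts

lemma copy_proper:
  assumes "R \<in> rects P" "i < num P"
  shows "xmin (horizontal_copy P i R) < xmax (horizontal_copy P i R)"
    "ymin (horizontal_copy P i R) < ymax (horizontal_copy P i R)"
    "xmin (vertical_copy P i R) < xmax (vertical_copy P i R)"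
    "ymin (vertical_copy P i R) < ymax (vertical_copy P i R)"
  using coordinate_facts(1-16)[OF assms(1)] side_facts by (auto simp: mult_less_cancel_left)

lemma meets_horizontal:
  assumes "R \<in> rects P" "S \<in> rects P" "i < num P" "j < num P"
  shows "meets (horizontal_copy P i R) (horizontal_copy P j S) \<longleftrightarrow> i = j \<and> meets R S"
  using assms copy_proper[OF assms(1,3)] copy_proper[OF assms(2,4)]
  by (subst (1 2) meets_iff)
     (auto simp: coordinate_facts digits_le mult_le_cancel_left xi_eq_iff less_imp_le add_nonneg_pos not_less
           dest: order_antisym)

lemma meets_vertical:
  assumes "R \<in> rects P" "S \<in> rects P" "i < num P" "j < num P"
  shows "meets (vertical_copy P i R) (vertical_copy P j S) \<longleftrightarrow> i = j \<and> meets R S"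
  using assms copy_proper[OF assms(1,3)] copy_proper[OF assms(2,4)]
  by (subst (1 2) meets_iff)
     (auto simp: coordinate_facts digits_le mult_le_cancel_left xi_eq_iff less_imp_le add_nonneg_pos not_less
           dest: order_antisym)

text \<open>The crossing law. The ends of a bar have trailing digit \<open>0\<close> in its long direction, so the
  digit comparison leaves strict inequalities between markers and borders; these agree with the weak
  ones because markers avoid borders.\<close>

lemma meets_horizontal_vertical:
  assumes "R \<in> rects P" "S \<in> rects P" "i < num P" "j < num P"
  shows "meets (horizontal_copy P i R) (vertical_copy P j S) \<longleftrightarrow> on_xi P j R \<and> on_xi P i S"
  using assms copy_proper[OF assms(1,3)] copy_proper[OF assms(2,4)]
  by (subst meets_iff)
     (auto simp: coordinate_facts digits_le_0 on_xi_def less_le)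

lemma horizontal_eq_iff:
  assumes "R \<in> rects P" "S \<in> rects P" "i < num P" "j < num P"
  shows "horizontal_copy P i R = horizontal_copy P j S \<longleftrightarrow> i = j \<and> R = S"
  using assms side_facts
  by (auto simp: rect_eq_iff coordinate_facts digits_eq)

lemma vertical_eq_iff:
  assumes "R \<in> rects P" "S \<in> rects P" "i < num P" "j < num P"
  shows "vertical_copy P i R = vertical_copy P j S \<longleftrightarrow> i = j \<and> R = S"
  using assms side_facts
  by (auto simp: rect_eq_iff coordinate_facts digits_eq)

lemma horizontal_neq_vertical:
  assumes "R \<in> rects P" "S \<in> rects P" "i < num P" "j < num P"
  shows "horizontal_copy P i R \<noteq> vertical_copy P j S"
  using assms
  by (auto simp: rect_eq_iff coordinate_facts digits_eq_0)

lemma marker_split: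
  assumes "k < num P * num P"
  shows "k div num P < num P" "k mod num P < num P"
  using assms by (auto simp: less_mult_imp_div_less) (metis gr_implies_not0 mod_less_divisor mult_0 neq0_conv)

text \<open>A new vertical marker \<open>(j, t)\<close> sees a horizontal bar only through \<open>j\<close>, whatever its index. A
  vertical bar has to have the index \<open>j\<close> and is then crossed according to the horizontal marker
  \<open>t\<close> of the old drawing. For horizontal markers the two directions change roles.\<close>

lemma on_xi_horizontal:
  assumes "R \<in> rects P" "i < num P" "k < num P * num P"
  shows "on_xi (crossbar P) k (horizontal_copy P i R) \<longleftrightarrow> on_xi P (k div num P) R"
  using assms marker_split[OF assms(3)]
  by (auto simp: on_xi_def xi_crossbar coordinate_facts digits_le_0 less_le)

lemma on_xi_vertical:
  assumes "R \<in> rects P" "i < num P" "k < num P * num P"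
  shows "on_xi (crossbar P) k (vertical_copy P i R) \<longleftrightarrow> k div num P = i \<and> on_eta P (k mod num P) R"
  using assms marker_split[OF assms(3)]
  by (auto simp: on_xi_def on_eta_def xi_crossbar coordinate_facts digits_le xi_eq_iff)

lemma on_eta_horizontal:
  assumes "R \<in> rects P" "i < num P" "k < num P * num P"
  shows "on_eta (crossbar P) k (horizontal_copy P i R) \<longleftrightarrow> k div num P = i \<and> on_eta P (k mod num P) R"
  using assms marker_split[OF assms(3)]
  by (auto simp: on_eta_def eta_crossbar coordinate_facts digits_le xi_eq_iff)

lemma on_eta_vertical:
  assumes "R \<in> rects P" "i < num P" "k < num P * num P"
  shows "on_eta (crossbar P) k (vertical_copy P i R) \<longleftrightarrow> on_xi P (k div num P) R"
  using assms marker_split[OF assms(3)]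
  by (auto simp: on_eta_def on_xi_def eta_crossbar coordinate_facts digits_le_0 less_le)

lemma crossbar_integral: "integral_drawing (crossbar P)"
proof -
  let ?M = "side P + 1"
  have fin: "finite (rects (crossbar P))"
    using finite_rects by (auto simp: rects_crossbar bars_def)
  have pair_le: "?M * a + u \<le> ?M * side P + side P" if "a \<le> side P" "u \<le> side P" for a u
    using that side_facts by (intro add_mono mult_left_mono) auto
  have pair_le0: "?M * a \<le> ?M * side P + side P" if "a \<le> side P" for a
    using pair_le[OF that, of 0] side_facts by simp
  have inj: "inj_on (\<lambda>k. ?M * xi P (k div num P) + eta P (k mod num P)) {..<num P * num P}"
  proof (rule inj_onI)
    fix k l assume kl: "k \<in> {..<num P * num P}" "l \<in> {..<num P * num P}"
      and eq: "?M * xi P (k div num P) + eta P (k mod num P) = ?M * xi P (l div num P) + eta P (l mod num P)"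
    have b: "k div num P < num P" "k mod num P < num P" "l div num P < num P" "l mod num P < num P"
      using kl marker_split by auto
    then have "k div num P = l div num P" "k mod num P = l mod num P"
      using eq by (auto simp: coordinate_facts digits_eq)
    then show "k = l" by (metis div_mult_mod_eq)
  qed
  have int: "{xmin R, xmax R, ymin R, ymax R} \<subseteq> \<int> \<and>
        0 \<le> xmin R \<and> xmin R < xmax R \<and> xmax R \<le> side (crossbar P) \<and>
        0 \<le> ymin R \<and> ymin R < ymax R \<and> ymax R \<le> side (crossbar P)"
    if "R \<in> rects (crossbar P)" for R
    using that copy_proper unfolding rects_crossbar bars_def
    by (auto simp: side_crossbar coordinate_facts pair_le pair_le0 intro!: Ints_add Ints_mult add_nonneg_nonneg mult_nonneg_nonneg)
  have mk: "{xi (crossbar P) k, eta (crossbar P) k} \<subseteq> \<int> \<and>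
        0 < xi (crossbar P) k \<and> xi (crossbar P) k \<le> side (crossbar P) \<and>
        0 < eta (crossbar P) k \<and> eta (crossbar P) k \<le> side (crossbar P)"
    if "k < num P * num P" for k
    using marker_split[OF that]
    by (auto simp: xi_crossbar eta_crossbar side_crossbar coordinate_facts pair_le
             intro!: Ints_add Ints_mult add_nonneg_pos mult_nonneg_nonneg)
  have av: "xi (crossbar P) k \<notin> {xmin R, xmax R} \<and> eta (crossbar P) k \<notin> {ymin R, ymax R}"
    if "R \<in> rects (crossbar P)" "k < num P * num P" for R k
    using that(1) marker_split[OF that(2)] unfolding rects_crossbar bars_def
    by (auto simp: xi_crossbar eta_crossbar coordinate_facts digits_eq_0 digits_eq)
  show ?thesis
    unfolding integral_drawing_def num_crossbar
    using fin int mk av inj side_facts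
    by (simp add: side_crossbar xi_crossbar[abs_def] eta_crossbar[abs_def])
qed

end

lemma base_integral: "integral_drawing base_drawing"
proof -
  have 4: "{..<4::nat} = {0,1,2,3}" by auto
  show ?thesis unfolding integral_drawing_def base_drawing_def
    by (simp add: 4 all_less_4 inj_on_def)
qed

section \<open>The packing number\<close>

text \<open>The markers of a crossbar are the numbers below \<open>q * q\<close>, read as pairs of digits in base \<open>q\<close>.\<close>

lemma sum_digits:
  fixes f :: "nat \<Rightarrow> nat \<Rightarrow> 'a::comm_monoid_add"
  shows "(\<Sum>k<q * q. f (k div q) (k mod q)) = (\<Sum>j<q. \<Sum>t<q. f j t)"
proof -
  have "(\<Sum>k<q * q. f (k div q) (k mod q)) = (\<Sum>(j, t)\<in>{..<q} \<times> {..<q}. f j t)"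
  proof (rule sum.reindex_bij_witness[where j = "\<lambda>k. (k div q, k mod q)" and i = "\<lambda>(j, t). j * q + t"])
    fix k assume "k \<in> {..<q * q}"
    then have "0 < q" "k div q < q" by (auto simp: less_mult_imp_div_less intro: gr0I)
    then show "(k div q, k mod q) \<in> {..<q} \<times> {..<q}" by simp
  next
    fix b assume "b \<in> {..<q} \<times> {..<q}"
    then obtain j t where b: "b = (j, t)" "j < q" "t < q" by auto
    have "j * q + t < j * q + q" using b by simp
    also have "\<dots> = Suc j * q" by simp
    also have "\<dots> \<le> q * q" using b by (intro mult_le_mono1) auto
    finally show "(case b of (j, t) \<Rightarrow> j * q + t) \<in> {..<q * q}" using b by simp
  qed auto
  then show ?thesis by (simp add: sum.cartesian_product)
qed

lemma card_filter_eq_sum: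
  fixes Q :: "'a \<Rightarrow> bool"
  assumes "finite B"
  shows "card {x \<in> B. Q x} = (\<Sum>x\<in>B. of_bool (Q x))"
  using assms by (simp add: Int_def)

lemma card_subset_eq_sum:
  assumes "finite B" "S \<subseteq> B"
  shows "card S = (\<Sum>x\<in>B. of_bool (x \<in> S))"
proof -
  have "{x \<in> B. x \<in> S} = S" using assms(2) by blast
  then show ?thesis using card_filter_eq_sum[OF assms(1), of "\<lambda>x. x \<in> S"] by simp
qed

lemma card_digits:
  fixes Q :: "nat \<Rightarrow> nat \<Rightarrow> bool"
  shows "card {k. k < q * q \<and> Q (k div q) (k mod q)} = (\<Sum>j<q. card {t. t < q \<and> Q j t})"
proof -
  have eq: "card {k. k < n \<and> R k} = (\<Sum>k<n. of_bool (R k))" for n :: nat and R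
    using card_filter_eq_sum[of "{..<n}" R] by simp
  show ?thesis
    unfolding eq by (rule sum_digits[where f = "\<lambda>j t. of_bool (Q j t)"])
qed

lemma card_copies:
  assumes P: "integral_drawing P" and G: "G \<subseteq> {..<num P}"
    and X: "\<And>i. i \<in> G \<Longrightarrow> X i \<subseteq> rects P" and Y: "\<And>i. i \<in> G \<Longrightarrow> Y i \<subseteq> rects P"
  shows "card ((\<Union>i\<in>G. horizontal_copy P i ` X i) \<union> (\<Union>i\<in>G. vertical_copy P i ` Y i))
    = (\<Sum>i\<in>G. card (X i)) + (\<Sum>i\<in>G. card (Y i))"
proof -
  have fG: "finite G" using G finite_subset by blast
  have fin: "finite (X i)" "finite (Y i)" if "i \<in> G" for i
    using X[OF that] Y[OF that] finite_rects[OF P] finite_subset by auto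
  have lt: "i < num P" if "i \<in> G" for i using that G by auto
  have injH: "i = j \<and> R = S"
    if "i \<in> G" "j \<in> G" "R \<in> X i" "S \<in> X j" "horizontal_copy P i R = horizontal_copy P j S" for i j R S
    using that X lt horizontal_eq_iff[OF P, of R S i j] by blast
  have injV: "i = j \<and> R = S"
    if "i \<in> G" "j \<in> G" "R \<in> Y i" "S \<in> Y j" "vertical_copy P i R = vertical_copy P j S" for i j R S
    using that Y lt vertical_eq_iff[OF P, of R S i j] by blast
  have HV: "horizontal_copy P i R \<noteq> vertical_copy P j S"
    if "i \<in> G" "j \<in> G" "R \<in> X i" "S \<in> Y j" for i j R S
    using that X Y lt horizontal_neq_vertical[OF P, of R S i j] by blast
  have "(\<Union>i\<in>G. horizontal_copy P i ` X i) \<inter> (\<Union>i\<in>G. vertical_copy P i ` Y i) = {}"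
    using HV by blast
  then have "card ((\<Union>i\<in>G. horizontal_copy P i ` X i) \<union> (\<Union>i\<in>G. vertical_copy P i ` Y i)) =
     card (\<Union>i\<in>G. horizontal_copy P i ` X i) + card (\<Union>i\<in>G. vertical_copy P i ` Y i)"
    using fG fin by (intro card_Un_disjoint) simp_all
  also have "card (\<Union>i\<in>G. horizontal_copy P i ` X i) = (\<Sum>i\<in>G. card (horizontal_copy P i ` X i))"
    using fG fin injH by (intro card_UN_disjoint) (simp_all, blast)
  also have "\<dots> = (\<Sum>i\<in>G. card (X i))"
    by (intro sum.cong refl card_image inj_onI) (blast dest: injH)
  also have "card (\<Union>i\<in>G. vertical_copy P i ` Y i) = (\<Sum>i\<in>G. card (vertical_copy P i ` Y i))"
    using fG fin injV by (intro card_UN_disjoint) (simp_all, blast)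
  also have "\<dots> = (\<Sum>i\<in>G. card (Y i))"
    by (intro sum.cong refl card_image inj_onI) (blast dest: injV)
  finally show ?thesis .
qed

lemma card_bars:
  assumes "integral_drawing P" "G \<subseteq> {..<num P}" "A \<subseteq> rects P"
  shows "card (bars P G A) = 2 * card G * card A"
  using card_copies[OF assms(1,2), of "\<lambda>_. A" "\<lambda>_. A"] assms(3)
  by (simp add: bars_def UN_Un_distrib)

definition packing :: "rect set \<Rightarrow> bool" where
  "packing S \<longleftrightarrow> pairwise (\<lambda>R R'. \<not> meets R R') S"

definition xi_trace :: "drawing \<Rightarrow> rect set \<Rightarrow> nat set" where
  "xi_trace P S = {k. k < num P \<and> (\<exists>R\<in>S. on_xi P k R)}"

definition eta_trace :: "drawing \<Rightarrow> rect set \<Rightarrow> nat set" where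
  "eta_trace P S = {k. k < num P \<and> (\<exists>R\<in>S. on_eta P k R)}"

text \<open>Both halves are needed together: the bound for vertical markers of the crossbar uses the bound
  for horizontal markers of the original drawing, and conversely.\<close>

definition trace_bounded :: "drawing \<Rightarrow> bool" where
  "trace_bounded P \<longleftrightarrow> (\<forall>S\<subseteq>rects P. packing S \<longrightarrow>
     card S \<le> card (xi_trace P S) \<and> card S \<le> card (eta_trace P S))"

text \<open>Here \<open>\<alpha> i\<close> and \<open>\<beta> j\<close> are the vertical traces of the packings in the \<open>i\<close>-th horizontal and the
  \<open>j\<close>-th vertical system, and \<open>\<gamma> j\<close> is the horizontal trace of the latter. The inequality holds for
  each leading digit \<open>j\<close> separately. If some \<open>\<alpha> i\<close> contains \<open>j\<close>, then all \<open>q\<close> markers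
  \<open>(j, t)\<close> count, and the \<open>i\<close> with \<open>j \<in> \<alpha> i\<close> are disjoint from \<open>\<beta> j\<close>. Otherwise only the
  \<open>j\<close>-th vertical system contributes on the left, and \<open>\<gamma> j\<close> pays for it.\<close>

lemma trace_count:
  fixes q :: nat and a b :: "nat \<Rightarrow> nat"
  assumes \<alpha>: "\<And>i. i < q \<Longrightarrow> a i \<le> card (\<alpha> i) \<and> \<alpha> i \<subseteq> {..<q}"
    and \<beta>: "\<And>j. j < q \<Longrightarrow> b j \<le> card (\<beta> j) \<and> \<beta> j \<subseteq> {..<q}"
    and \<gamma>: "\<And>j. j < q \<Longrightarrow> b j \<le> card (\<gamma> j) \<and> \<gamma> j \<subseteq> {..<q}"
    and excl: "\<And>i j. \<lbrakk>i < q; j < q; j \<in> \<alpha> i\<rbrakk> \<Longrightarrow> i \<notin> \<beta> j"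
  shows "(\<Sum>i<q. a i) + (\<Sum>j<q. b j)
    \<le> card {k. k < q * q \<and> ((\<exists>i<q. k div q \<in> \<alpha> i) \<or> k mod q \<in> \<gamma> (k div q))}"
proof -
  have "card (\<alpha> i) = (\<Sum>j<q. of_bool (j \<in> \<alpha> i))" if "i < q" for i
    using \<alpha>[OF that] by (subst sum_of_bool_eq) (auto intro: arg_cong[where f = card])
  then have "(\<Sum>i<q. a i) \<le> (\<Sum>i<q. \<Sum>j<q. of_bool (j \<in> \<alpha> i))"
    using \<alpha> by (intro sum_mono) (metis lessThan_iff)
  also have "\<dots> = (\<Sum>j<q. \<Sum>i<q. of_bool (j \<in> \<alpha> i))"
    by (rule sum.swap)
  also have "\<dots> = (\<Sum>j<q. card {i. i < q \<and> j \<in> \<alpha> i})"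
    by (intro sum.cong refl, subst sum_of_bool_eq) (auto intro: arg_cong[where f = card])
  finally have "(\<Sum>i<q. a i) + (\<Sum>j<q. b j) \<le> (\<Sum>j<q. card {i. i < q \<and> j \<in> \<alpha> i} + b j)"
    by (simp add: sum.distrib)
  also have "\<dots> \<le> (\<Sum>j<q. card {t. t < q \<and> ((\<exists>i<q. j \<in> \<alpha> i) \<or> t \<in> \<gamma> j)})"
  proof (rule sum_mono)
    fix j assume "j \<in> {..<q}"
    then have j: "j < q" by simp
    show "card {i. i < q \<and> j \<in> \<alpha> i} + b j \<le> card {t. t < q \<and> ((\<exists>i<q. j \<in> \<alpha> i) \<or> t \<in> \<gamma> j)}"
    proof (cases "\<exists>i<q. j \<in> \<alpha> i")
      case True
      have fin: "finite (\<beta> j)" using \<beta>[OF j] finite_subset by blast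
      have "card {i. i < q \<and> j \<in> \<alpha> i} + b j \<le> card {i. i < q \<and> j \<in> \<alpha> i} + card (\<beta> j)"
        using \<beta>[OF j] by simp
      also have "\<dots> = card ({i. i < q \<and> j \<in> \<alpha> i} \<union> \<beta> j)"
        using fin excl j by (intro card_Un_disjoint[symmetric]) auto
      also have "\<dots> \<le> card {..<q}"
        using \<beta>[OF j] by (intro card_mono) auto
      finally show ?thesis using True by (simp flip: lessThan_def)
    next
      case False
      then have e: "{i. i < q \<and> j \<in> \<alpha> i} = {}" by auto
      have g: "{t. t < q \<and> ((\<exists>i<q. j \<in> \<alpha> i) \<or> t \<in> \<gamma> j)} = \<gamma> j"
        using False \<gamma>[OF j] by auto
      show ?thesis unfolding e g using \<gamma>[OF j] by simp
    qed
  qed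
  also have "\<dots> = card {k. k < q * q \<and> ((\<exists>i<q. k div q \<in> \<alpha> i) \<or> k mod q \<in> \<gamma> (k div q))}"
    by (rule card_digits[symmetric])
  finally show ?thesis .
qed

lemma trace_bounded_crossbar:
  assumes P: "integral_drawing P" and tb: "trace_bounded P"
  shows "trace_bounded (crossbar P)"
  unfolding trace_bounded_def
proof (intro allI impI)
  fix S assume S: "S \<subseteq> rects (crossbar P)" and pk: "packing S"
  let ?q = "num P"
  \<comment> \<open>The packings induced in the copies of \<open>P\<close>.\<close>
  define X where "X i = {R \<in> rects P. horizontal_copy P i R \<in> S}" for i
  define Y where "Y i = {R \<in> rects P. vertical_copy P i R \<in> S}" for i
  have XS: "R \<in> rects P" "horizontal_copy P i R \<in> S" if "R \<in> X i" for i R using that by (auto simp: X_def)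
  have YS: "R \<in> rects P" "vertical_copy P i R \<in> S" if "R \<in> Y i" for i R using that by (auto simp: Y_def)
  have S_eq: "S = (\<Union>i\<in>{..<?q}. horizontal_copy P i ` X i) \<union> (\<Union>i\<in>{..<?q}. vertical_copy P i ` Y i)"
    using S unfolding rects_crossbar bars_def X_def Y_def by fastforce
  have card_S: "card S = (\<Sum>i<?q. card (X i)) + (\<Sum>i<?q. card (Y i))"
    by (subst S_eq, rule card_copies[OF P]) (auto simp: X_def Y_def)
  have nm: "\<not> meets R R'" if "R \<in> S" "R' \<in> S" "R \<noteq> R'" for R R'
    using pk that unfolding packing_def pairwise_def by blast
  have pX: "packing (X i)" if "i < ?q" for i
    unfolding packing_def
  proof (rule pairwiseI)
    fix R R' assume R: "R \<in> X i" "R' \<in> X i" "R \<noteq> R'"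
    then show "\<not> meets R R'"
      using nm[OF XS(2)[OF R(1)] XS(2)[OF R(2)]] XS(1)[OF R(1)] XS(1)[OF R(2)]
        meets_horizontal[OF P _ _ that that] horizontal_eq_iff[OF P _ _ that that] by auto
  qed
  have pY: "packing (Y i)" if "i < ?q" for i
    unfolding packing_def
  proof (rule pairwiseI)
    fix R R' assume R: "R \<in> Y i" "R' \<in> Y i" "R \<noteq> R'"
    then show "\<not> meets R R'"
      using nm[OF YS(2)[OF R(1)] YS(2)[OF R(2)]] YS(1)[OF R(1)] YS(1)[OF R(2)]
        meets_vertical[OF P _ _ that that] vertical_eq_iff[OF P _ _ that that] by auto
  qed
  have bX: "card (X i) \<le> card (xi_trace P (X i))" "card (X i) \<le> card (eta_trace P (X i))" if "i < ?q" for i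
    using tb pX[OF that] XS(1)[of _ i] unfolding trace_bounded_def by (auto simp: subset_iff)
  have bY: "card (Y i) \<le> card (xi_trace P (Y i))" "card (Y i) \<le> card (eta_trace P (Y i))" if "i < ?q" for i
    using tb pY[OF that] YS(1)[of _ i] unfolding trace_bounded_def by (auto simp: subset_iff)
  have excl: "i \<notin> xi_trace P (Y j)" if lt: "i < ?q" "j < ?q" and j: "j \<in> xi_trace P (X i)" for i j
  proof
    assume "i \<in> xi_trace P (Y j)"
    then obtain R R' where R: "R \<in> X i" "R' \<in> Y j" "on_xi P j R" "on_xi P i R'"
      using j by (auto simp: xi_trace_def)
    then have "meets (horizontal_copy P i R) (vertical_copy P j R')"
      using meets_horizontal_vertical[OF P _ _ lt] XS(1)[OF R(1)] YS(1)[OF R(2)] by simp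
    moreover have "horizontal_copy P i R \<noteq> vertical_copy P j R'"
      using horizontal_neq_vertical[OF P _ _ lt] XS(1)[OF R(1)] YS(1)[OF R(2)] by simp
    ultimately show False using nm XS(2)[OF R(1)] YS(2)[OF R(2)] by blast
  qed
  have sub: "xi_trace P Z \<subseteq> {..<?q}" "eta_trace P Z \<subseteq> {..<?q}" for Z
    by (auto simp: xi_trace_def eta_trace_def)
  have "card S \<le> card {k. k < ?q * ?q \<and> ((\<exists>i<?q. k div ?q \<in> xi_trace P (X i)) \<or> k mod ?q \<in> eta_trace P (Y (k div ?q)))}"
    unfolding card_S using bX bY excl sub by (intro trace_count[where \<beta> = "\<lambda>j. xi_trace P (Y j)"]) auto
  also have "\<dots> \<le> card (xi_trace (crossbar P) S)"
  proof (rule card_mono)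
    show "{k. k < ?q * ?q \<and> ((\<exists>i<?q. k div ?q \<in> xi_trace P (X i)) \<or> k mod ?q \<in> eta_trace P (Y (k div ?q)))}
      \<subseteq> xi_trace (crossbar P) S"
    proof (intro subsetI, elim CollectE conjE disjE exE)
      fix k i assume k: "k < ?q * ?q" "i < ?q" "k div ?q \<in> xi_trace P (X i)"
      then obtain R where R: "R \<in> X i" "on_xi P (k div ?q) R" by (auto simp: xi_trace_def)
      then show "k \<in> xi_trace (crossbar P) S"
        using on_xi_horizontal[OF P XS(1)[OF R(1)] k(2,1)] XS(2)[OF R(1)] k(1)
        by (auto simp: xi_trace_def)
    next
      fix k assume k: "k < ?q * ?q" "k mod ?q \<in> eta_trace P (Y (k div ?q))"
      then obtain R where R: "R \<in> Y (k div ?q)" "on_eta P (k mod ?q) R" by (auto simp: eta_trace_def)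
      then show "k \<in> xi_trace (crossbar P) S"
        using on_xi_vertical[OF P YS(1)[OF R(1)] marker_split(1)[OF P k(1)] k(1)] YS(2)[OF R(1)] k(1)
        by (auto simp: xi_trace_def)
    qed
  qed (simp add: xi_trace_def)
  finally have 1: "card S \<le> card (xi_trace (crossbar P) S)" .
  \<comment> \<open>For horizontal markers the two kinds of bars exchange their roles.\<close>
  have "card S \<le> card {k. k < ?q * ?q \<and> ((\<exists>i<?q. k div ?q \<in> xi_trace P (Y i)) \<or> k mod ?q \<in> eta_trace P (X (k div ?q)))}"
    unfolding card_S add.commute[of "\<Sum>i<?q. card (X i)"]
    using bX bY excl sub by (intro trace_count[where \<beta> = "\<lambda>j. xi_trace P (X j)"]) auto
  also have "\<dots> \<le> card (eta_trace (crossbar P) S)"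
  proof (rule card_mono)
    show "{k. k < ?q * ?q \<and> ((\<exists>i<?q. k div ?q \<in> xi_trace P (Y i)) \<or> k mod ?q \<in> eta_trace P (X (k div ?q)))}
      \<subseteq> eta_trace (crossbar P) S"
    proof (intro subsetI, elim CollectE conjE disjE exE)
      fix k i assume k: "k < ?q * ?q" "i < ?q" "k div ?q \<in> xi_trace P (Y i)"
      then obtain R where R: "R \<in> Y i" "on_xi P (k div ?q) R" by (auto simp: xi_trace_def)
      then show "k \<in> eta_trace (crossbar P) S"
        using on_eta_vertical[OF P YS(1)[OF R(1)] k(2,1)] YS(2)[OF R(1)] k(1)
        by (auto simp: eta_trace_def)
    next
      fix k assume k: "k < ?q * ?q" "k mod ?q \<in> eta_trace P (X (k div ?q))"
      then obtain R where R: "R \<in> X (k div ?q)" "on_eta P (k mod ?q) R" by (auto simp: eta_trace_def)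
      then show "k \<in> eta_trace (crossbar P) S"
        using on_eta_horizontal[OF P XS(1)[OF R(1)] marker_split(1)[OF P k(1)] k(1)] XS(2)[OF R(1)] k(1)
        by (auto simp: eta_trace_def)
    qed
  qed (simp add: eta_trace_def)
  finally show "card S \<le> card (xi_trace (crossbar P) S) \<and> card S \<le> card (eta_trace (crossbar P) S)"
    using 1 by simp
qed

text \<open>The next two lemmas are the trace bounds of the base drawing, with a truth value for the
  membership of each rectangle in the packing: \<open>t\<close> for the long top rectangle \<open>T\<close>, \<open>u\<close> and \<open>u'\<close> for
  \<open>U\<^sub>L\<close> and \<open>U\<^sub>R\<close>, and \<open>c0, c1, c2, c3, d\<close> for the five-cycle, where \<open>d\<close> stands for \<open>Q\<close>.\<close>

lemma base_xi_count:
  fixes t u u' c0 c1 c2 c3 d :: bool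
  assumes "\<not> (u \<and> u')" "\<not> (c0 \<and> c1)" "\<not> (c1 \<and> c2)" "\<not> (c2 \<and> c3)" "\<not> (c3 \<and> d)" "\<not> (d \<and> c0)"
  shows "of_bool t + of_bool u + of_bool u' + of_bool c0 + of_bool c1 + of_bool c2 + of_bool c3 + of_bool d
      \<le> (of_bool (t \<or> u \<or> c0) + of_bool (t \<or> u \<or> c1 \<or> d) + of_bool (t \<or> u' \<or> c2 \<or> d)
         + of_bool (t \<or> u' \<or> c3) :: nat)"
  using assms by (cases c0; cases c1; cases c2; cases c3; cases d; simp)

lemma base_eta_count:
  fixes t u u' c0 c1 c2 c3 d :: bool
  assumes "\<not> (u \<and> u')" "\<not> (c0 \<and> c1)" "\<not> (c1 \<and> c2)" "\<not> (c2 \<and> c3)" "\<not> (c3 \<and> d)" "\<not> (d \<and> c0)"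
  shows "of_bool t + of_bool u + of_bool u' + of_bool c0 + of_bool c1 + of_bool c2 + of_bool c3 + of_bool d
      \<le> (of_bool (c0 \<or> c3 \<or> d) + of_bool (c1 \<or> c2 \<or> c3) + of_bool (u \<or> u') + of_bool t :: nat)"
  using assms by (cases c0; cases c1; cases c2; cases c3; cases d; auto)

lemma trace_bounded_base: "trace_bounded base_drawing"
  unfolding trace_bounded_def
proof (intro allI impI)
  fix S assume S: "S \<subseteq> rects base_drawing" and pk: "packing S"
  have fin: "finite (rects base_drawing)" by (simp add: base_drawing_def)
  have card_S: "card S = (\<Sum>R\<in>rects base_drawing. of_bool (R \<in> S))"
    by (rule card_subset_eq_sum[OF fin S])
  have eq: "card {k. k < n \<and> Q k} = (\<Sum>k<n. of_bool (Q k))" for n :: nat and Q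
    using card_filter_eq_sum[of "{..<n}" Q] by simp
  have n4: "num base_drawing = 4" by (simp add: base_drawing_def)
  have ex: "(\<exists>R\<in>S. Q R) \<longleftrightarrow> (\<exists>R\<in>rects base_drawing. R \<in> S \<and> Q R)" for Q
    using S by blast
  have nm: "\<not> (R \<in> S \<and> R' \<in> S)" if "R \<noteq> R'" "meets R R'" for R R'
    using pk that unfolding packing_def pairwise_def by blast
  have xi:
    "(\<exists>R\<in>S. on_xi base_drawing 0 R) \<longleftrightarrow>
      (Rect 0 30 26 28 \<in> S \<or> Rect 0 16 20 22 \<in> S \<or> Rect 0 8 2 10 \<in> S)"
    "(\<exists>R\<in>S. on_xi base_drawing 1 R) \<longleftrightarrow>
      (Rect 0 30 26 28 \<in> S \<or> Rect 0 16 20 22 \<in> S \<or> Rect 6 16 8 14 \<in> S \<or> Rect 6 24 0 4 \<in> S)"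
    "(\<exists>R\<in>S. on_xi base_drawing 2 R) \<longleftrightarrow>
      (Rect 0 30 26 28 \<in> S \<or> Rect 14 30 20 22 \<in> S \<or> Rect 14 24 8 14 \<in> S \<or> Rect 6 24 0 4 \<in> S)"
    "(\<exists>R\<in>S. on_xi base_drawing 3 R) \<longleftrightarrow>
      (Rect 0 30 26 28 \<in> S \<or> Rect 14 30 20 22 \<in> S \<or> Rect 22 30 2 12 \<in> S)"
    unfolding ex by (simp_all add: base_drawing_def on_xi_def)
  have eta:
    "(\<exists>R\<in>S. on_eta base_drawing 0 R) \<longleftrightarrow>
      (Rect 0 8 2 10 \<in> S \<or> Rect 22 30 2 12 \<in> S \<or> Rect 6 24 0 4 \<in> S)"
    "(\<exists>R\<in>S. on_eta base_drawing 1 R) \<longleftrightarrow>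
      (Rect 6 16 8 14 \<in> S \<or> Rect 14 24 8 14 \<in> S \<or> Rect 22 30 2 12 \<in> S)"
    "(\<exists>R\<in>S. on_eta base_drawing 2 R) \<longleftrightarrow>
      (Rect 0 16 20 22 \<in> S \<or> Rect 14 30 20 22 \<in> S)"
    "(\<exists>R\<in>S. on_eta base_drawing 3 R) \<longleftrightarrow>
      (Rect 0 30 26 28 \<in> S)"
    unfolding ex by (simp_all add: base_drawing_def on_eta_def)
  have disj:
    "\<not> (Rect 0 16 20 22 \<in> S \<and> Rect 14 30 20 22 \<in> S)"
    "\<not> (Rect 0 8 2 10 \<in> S \<and> Rect 6 16 8 14 \<in> S)"
    "\<not> (Rect 6 16 8 14 \<in> S \<and> Rect 14 24 8 14 \<in> S)"
    "\<not> (Rect 14 24 8 14 \<in> S \<and> Rect 22 30 2 12 \<in> S)"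
    "\<not> (Rect 22 30 2 12 \<in> S \<and> Rect 6 24 0 4 \<in> S)"
    "\<not> (Rect 6 24 0 4 \<in> S \<and> Rect 0 8 2 10 \<in> S)"
    by (rule nm; simp add: meets_iff)+
  have cS: "card S = of_bool (Rect 0 30 26 28 \<in> S) + of_bool (Rect 0 16 20 22 \<in> S)
      + of_bool (Rect 14 30 20 22 \<in> S) + of_bool (Rect 0 8 2 10 \<in> S) + of_bool (Rect 6 16 8 14 \<in> S)
      + of_bool (Rect 14 24 8 14 \<in> S) + of_bool (Rect 22 30 2 12 \<in> S) + of_bool (Rect 6 24 0 4 \<in> S)"
    unfolding card_S by (simp add: base_drawing_def)
  have cxi: "card (xi_trace base_drawing S) =
      of_bool (Rect 0 30 26 28 \<in> S \<or> Rect 0 16 20 22 \<in> S \<or> Rect 0 8 2 10 \<in> S)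
      + of_bool (Rect 0 30 26 28 \<in> S \<or> Rect 0 16 20 22 \<in> S \<or> Rect 6 16 8 14 \<in> S \<or> Rect 6 24 0 4 \<in> S)
      + of_bool (Rect 0 30 26 28 \<in> S \<or> Rect 14 30 20 22 \<in> S \<or> Rect 14 24 8 14 \<in> S \<or> Rect 6 24 0 4 \<in> S)
      + of_bool (Rect 0 30 26 28 \<in> S \<or> Rect 14 30 20 22 \<in> S \<or> Rect 22 30 2 12 \<in> S)"
    unfolding xi_trace_def eq n4 sum_less_4 xi by (rule refl)
  have ceta: "card (eta_trace base_drawing S) =
      of_bool (Rect 0 8 2 10 \<in> S \<or> Rect 22 30 2 12 \<in> S \<or> Rect 6 24 0 4 \<in> S)
      + of_bool (Rect 6 16 8 14 \<in> S \<or> Rect 14 24 8 14 \<in> S \<or> Rect 22 30 2 12 \<in> S)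
      + of_bool (Rect 0 16 20 22 \<in> S \<or> Rect 14 30 20 22 \<in> S)
      + of_bool (Rect 0 30 26 28 \<in> S)"
    unfolding eta_trace_def eq n4 sum_less_4 eta by (rule refl)
  show "card S \<le> card (xi_trace base_drawing S) \<and> card S \<le> card (eta_trace base_drawing S)"
    unfolding cS cxi ceta using base_xi_count[OF disj] base_eta_count[OF disj] by (rule conjI)
qed

lemma packing_crossbar:
  assumes P: "integral_drawing P" and A: "A \<subseteq> rects P" "packing A"
  shows "\<exists>B\<subseteq>rects (crossbar P). packing B \<and> card B = num P * card A"
proof (intro exI conjI)
  let ?B = "\<Union>i<num P. horizontal_copy P i ` A"
  show "?B \<subseteq> rects (crossbar P)"
    using A by (auto simp: rects_crossbar bars_def)
  show "packing ?B"
    unfolding packing_def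
  proof (rule pairwiseI)
    fix R R' assume "R \<in> ?B" "R' \<in> ?B" and ne: "R \<noteq> R'"
    then obtain i S i' S' where *: "i < num P" "S \<in> A" "R = horizontal_copy P i S"
       "i' < num P" "S' \<in> A" "R' = horizontal_copy P i' S'" by auto
    have "S \<in> rects P" "S' \<in> rects P" using * A by auto
    then show "\<not> meets R R'"
      using ne * A(2) meets_horizontal[OF P, of S S' i i'] unfolding packing_def pairwise_def
      by auto
  qed
  show "card ?B = num P * card A"
    using card_copies[OF P, of "{..<num P}" "\<lambda>_. A" "\<lambda>_. {}"] A by simp
qed

lemma packing_base: "\<exists>A\<subseteq>rects base_drawing. packing A \<and> card A = 4"
proof (intro exI conjI)
  let ?A = "{Rect 0 30 26 28, Rect 0 16 20 22, Rect 0 8 2 10, Rect 14 24 8 14}"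
  show "?A \<subseteq> rects base_drawing" by (simp add: base_drawing_def)
  show "packing ?A" by (auto simp: packing_def pairwise_insert meets_iff)
  show "card ?A = 4" by simp
qed

lemma drawing_seq_Suc: "drawing_seq (Suc r) = crossbar (drawing_seq r)"
  by (simp add: drawing_seq_def)

lemma drawing_seq_0: "drawing_seq 0 = base_drawing"
  by (simp add: drawing_seq_def)

lemma drawing_seq_integral: "integral_drawing (drawing_seq r)"
  by (induction r) (simp_all add: drawing_seq_0 drawing_seq_Suc base_integral crossbar_integral)

lemma num_drawing_seq: "num (drawing_seq r) = 4 ^ 2 ^ r"
proof (induction r)
  case 0
  then show ?case by (simp add: drawing_seq_0 base_drawing_def)
next
  case (Suc r)
  have "(2::nat) ^ Suc r = 2 ^ r + 2 ^ r" by simp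
  then show ?case using Suc by (simp add: drawing_seq_Suc flip: power_add)
qed

lemma trace_bounded_drawing_seq: "trace_bounded (drawing_seq r)"
  by (induction r)
     (simp_all add: drawing_seq_0 drawing_seq_Suc trace_bounded_base trace_bounded_crossbar drawing_seq_integral)

lemma packing_drawing_seq: "\<exists>A\<subseteq>rects (drawing_seq r). packing A \<and> card A = num (drawing_seq r)"
proof (induction r)
  case 0
  have "num base_drawing = 4" by (simp add: base_drawing_def)
  then show ?case using packing_base by (simp add: drawing_seq_0)
next
  case (Suc r)
  then obtain A where "A \<subseteq> rects (drawing_seq r)" "packing A" "card A = num (drawing_seq r)" by blast
  then show ?case
    using packing_crossbar[OF drawing_seq_integral, of A r] by (simp add: drawing_seq_Suc)
qed

lemma packing_iff_disjoint: "packing S \<longleftrightarrow> disjoint_family_on region S"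
  unfolding packing_def pairwise_def meets_def disjoint_family_on_def by blast

lemma packing_number_rect_family: "packing_number (rect_family r) = 4 ^ 2 ^ r"
  unfolding packing_number_def
proof (rule Max_eqI)
  have fin: "finite (rect_family r)"
    unfolding rect_family_def by (rule finite_rects[OF drawing_seq_integral])
  show "finite {card S |S. S \<subseteq> rect_family r \<and> disjoint_family_on region S}"
    by (rule finite_subset[of _ "card ` Pow (rect_family r)"]) (use fin in auto)
next
  fix n assume "n \<in> {card S |S. S \<subseteq> rect_family r \<and> disjoint_family_on region S}"
  then obtain S where S: "S \<subseteq> rects (drawing_seq r)" "packing S" "n = card S"
    by (auto simp: rect_family_def packing_iff_disjoint)
  then have "n \<le> card (xi_trace (drawing_seq r) S)"
    using trace_bounded_drawing_seq[of r] unfolding trace_bounded_def by auto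
  also have "\<dots> \<le> card {..<num (drawing_seq r)}"
    by (intro card_mono) (auto simp: xi_trace_def)
  finally show "n \<le> 4 ^ 2 ^ r" by (simp add: num_drawing_seq)
next
  show "4 ^ 2 ^ r \<in> {card S |S. S \<subseteq> rect_family r \<and> disjoint_family_on region S}"
  proof -
    obtain A where "A \<subseteq> rect_family r" "disjoint_family_on region A" "card A = 4 ^ 2 ^ r"
      using packing_drawing_seq[of r] unfolding rect_family_def packing_iff_disjoint num_drawing_seq by blast
    then show ?thesis by (auto intro!: exI[of _ A])
  qed
qed

section \<open>Piercing with marker crossings\<close>

text \<open>Pairs up, with multiplicities, the points that a horizontal system uses on one marker with
  the points that a vertical system uses on another.\<close>

lemma transport_plan:
  fixes a b :: "nat \<Rightarrow> nat"
  assumes "(\<Sum>s<q. a s) = (\<Sum>t<q. b t)"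
  shows "\<exists>u. (\<forall>s<q. (\<Sum>t<q. u s t) = a s) \<and> (\<forall>t<q. (\<Sum>s<q. u s t) = b t)"
  using assms
proof (induction "\<Sum>s<q. a s" arbitrary: a b)
  case 0
  then have "\<forall>s<q. a s = 0" "\<forall>t<q. b t = 0" by (auto simp: sum_eq_0_iff eq_commute[of 0])
  then show ?case by (intro exI[of _ "\<lambda>_ _. 0"]) simp
next
  case (Suc n)
  obtain s0 where s0: "s0 < q" "0 < a s0"
  proof (rule ccontr)
    assume "\<not> thesis"
    then have "\<forall>s<q. a s = 0" using that by blast
    then have "(\<Sum>s<q. a s) = 0" by simp
    then show False using Suc.hyps(2) by simp
  qed
  obtain t0 where t0: "t0 < q" "0 < b t0"
  proof (rule ccontr)
    assume "\<not> thesis"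
    then have "\<forall>s<q. b s = 0" using that by blast
    then have "(\<Sum>s<q. b s) = 0" by simp
    then show False using Suc.hyps(2) Suc.prems by simp
  qed
  define a' where "a' s = a s - of_bool (s = s0)" for s
  define b' where "b' t = b t - of_bool (t = t0)" for t
  have a: "a s = a' s + of_bool (s = s0)" for s using s0 by (auto simp: a'_def)
  have b: "b t = b' t + of_bool (t = t0)" for t using t0 by (auto simp: b'_def)
  have ind: "(\<Sum>s<q. of_bool (s = s0)) = (1::nat)" if "s0 < q" for s0
    using that by (subst sum_of_bool_eq) auto
  have "(\<Sum>s<q. a s) = (\<Sum>s<q. a' s) + 1" "(\<Sum>t<q. b t) = (\<Sum>t<q. b' t) + 1"
    unfolding a b sum.distrib using ind s0 t0 by simp_all
  then have "n = (\<Sum>s<q. a' s)" "(\<Sum>s<q. a' s) = (\<Sum>t<q. b' t)"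
    using Suc.hyps(2) Suc.prems by simp_all
  from Suc.hyps(1)[OF this] obtain u where
    u: "\<forall>s<q. (\<Sum>t<q. u s t) = a' s" "\<forall>t<q. (\<Sum>s<q. u s t) = b' t" by blast
  have "(\<Sum>t<q. u s t + of_bool (s = s0 \<and> t = t0)) = a s" if "s < q" for s
    using u(1) that ind[OF t0(1)] by (cases "s = s0") (simp_all add: sum.distrib a)
  moreover have "(\<Sum>s<q. u s t + of_bool (s = s0 \<and> t = t0)) = b t" if "t < q" for t
    using u(2) that ind[OF s0(1)] by (cases "t = t0") (simp_all add: sum.distrib b)
  ultimately show ?case
    by (intro exI[of _ "\<lambda>s t. u s t + of_bool (s = s0 \<and> t = t0)"]) blast
qed

definition outer :: "nat \<Rightarrow> bool" where
  "outer k \<longleftrightarrow> k mod 4 = 0 \<or> k mod 4 = 3"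

text \<open>The number of points prescribed on marker \<open>k\<close>. In each block of four consecutive markers
  these numbers are \<open>3, 2, 2, 3\<close> or \<open>2, 3, 3, 2\<close>, depending on \<open>\<epsilon>\<close>. For a constant sequence
  \<open>\<epsilon> = outer i\<close> the value at \<open>j\<close> is symmetric in \<open>i\<close> and \<open>j\<close>, which is what makes the systems of a
  crossbar compatible.\<close>

definition point_pattern :: "(nat \<Rightarrow> bool) \<Rightarrow> nat \<Rightarrow> nat" where
  "point_pattern \<epsilon> k = (if outer k = \<epsilon> (k div 4) then 3 else 2)"

lemma point_pattern_first:
  "point_pattern \<epsilon> 0 = (if \<epsilon> 0 then 3 else 2)" "point_pattern \<epsilon> 1 = (if \<epsilon> 0 then 2 else 3)"
  "point_pattern \<epsilon> 2 = (if \<epsilon> 0 then 2 else 3)" "point_pattern \<epsilon> 3 = (if \<epsilon> 0 then 3 else 2)"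
  by (simp_all add: point_pattern_def outer_def)

lemma point_pattern_block:
  assumes "4 dvd q"
  shows "point_pattern \<epsilon> (j * q + t) = point_pattern (\<lambda>a. \<epsilon> (j * (q div 4) + a)) t"
proof -
  obtain m where m: "q = 4 * m" using assms by blast
  have eq: "j * q + t = t + 4 * (j * m)" by (simp add: m)
  have "(j * q + t) div 4 = j * m + t div 4" "(j * q + t) mod 4 = t mod 4"
    unfolding eq by simp_all
  then show ?thesis by (simp add: point_pattern_def outer_def m)
qed

lemma sum_point_pattern: "(\<Sum>k<4 * m. point_pattern \<epsilon> k) = 10 * m"
proof (induction m)
  case (Suc m)
  have "(\<Sum>k<4 * Suc m. point_pattern \<epsilon> k) = (\<Sum>k<4 * m + 4. point_pattern \<epsilon> k)"
    by (simp add: add.commute)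
  also have "\<dots> = (\<Sum>k<4 * m. point_pattern \<epsilon> k) + (\<Sum>k<4. point_pattern \<epsilon> (4 * m + k))"
    by (rule sum.nat_group[symmetric] | simp add: sum.lessThan_Suc numeral_eq_Suc add.assoc)
  also have "(\<Sum>k<4. point_pattern \<epsilon> (4 * m + k)) = 10"
    by (simp add: sum_less_4 point_pattern_def outer_def)
  finally show ?case using Suc by simp
qed simp

text \<open>A multiset of marker crossings that pierces the drawing, \<open>w k l\<close> being the multiplicity of
  the crossing of the \<open>k\<close>-th vertical with the \<open>l\<close>-th horizontal marker. Its numbers of points per marker
  follow prescribed patterns in both directions.\<close>

definition covering_weights :: "drawing \<Rightarrow> (nat \<Rightarrow> bool) \<Rightarrow> (nat \<Rightarrow> bool) \<Rightarrow> (nat \<Rightarrow> nat \<Rightarrow> nat) \<Rightarrow> bool" where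
  "covering_weights P \<epsilon> \<delta> w \<longleftrightarrow>
     (\<forall>k<num P. (\<Sum>l<num P. w k l) = point_pattern \<epsilon> k) \<and>
     (\<forall>l<num P. (\<Sum>k<num P. w k l) = point_pattern \<delta> l) \<and>
     (\<forall>R\<in>rects P. \<exists>k<num P. \<exists>l<num P. 0 < w k l \<and> on_xi P k R \<and> on_eta P l R)"

text \<open>The listed crossings lie in \<open>C\<^sub>0\<close>, \<open>T\<close>, \<open>C\<^sub>1\<close>, \<open>U\<^sub>L\<close>, \<open>Q\<close>, \<open>C\<^sub>2\<close> and \<open>U\<^sub>R\<close>, in this order; the
  last premise offers two crossings for \<open>C\<^sub>3\<close>.\<close>

lemma covering_weights_baseI:
  assumes "\<forall>k<4. w k 0 + w k 1 + w k 2 + w k 3 = point_pattern \<epsilon> k"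
    and "\<forall>l<4. w 0 l + w 1 l + w 2 l + w 3 l = point_pattern \<delta> l"
    and pos: "0 < w 0 0" "0 < w 0 3" "0 < w 1 1" "0 < w 1 2" "0 < w 2 0" "0 < w 2 1" "0 < w 3 2"
      "0 < w 3 0 \<or> 0 < w 3 1"
  shows "covering_weights base_drawing \<epsilon> \<delta> w"
proof -
  have num: "num base_drawing = 4" by (simp add: base_drawing_def)
  have hit: "\<exists>k<4. \<exists>l<4. 0 < w k l \<and> on_xi base_drawing k R \<and> on_eta base_drawing l R"
    if "k < 4" "l < 4" "0 < w k l" "on_xi base_drawing k R" "on_eta base_drawing l R" for k l R
    using that by blast
  have "\<exists>k<4. \<exists>l<4. 0 < w k l \<and> on_xi base_drawing k R \<and> on_eta base_drawing l R"
    if "R \<in> rects base_drawing" for R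
  proof -
    have "R = Rect 0 30 26 28 \<or> R = Rect 0 16 20 22 \<or> R = Rect 14 30 20 22 \<or> R = Rect 0 8 2 10
      \<or> R = Rect 6 16 8 14 \<or> R = Rect 14 24 8 14 \<or> R = Rect 22 30 2 12 \<or> R = Rect 6 24 0 4"
      using that by (simp add: base_drawing_def)
    then show ?thesis
    proof (elim disjE)
      assume "R = Rect 0 30 26 28"
      then show ?thesis using pos by (intro hit[of 0 3]) (simp_all add: base_drawing_def on_xi_def on_eta_def)
    next
      assume "R = Rect 0 16 20 22"
      then show ?thesis using pos by (intro hit[of 1 2]) (simp_all add: base_drawing_def on_xi_def on_eta_def)
    next
      assume "R = Rect 14 30 20 22"
      then show ?thesis using pos by (intro hit[of 3 2]) (simp_all add: base_drawing_def on_xi_def on_eta_def)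
    next
      assume "R = Rect 0 8 2 10"
      then show ?thesis using pos by (intro hit[of 0 0]) (simp_all add: base_drawing_def on_xi_def on_eta_def)
    next
      assume "R = Rect 6 16 8 14"
      then show ?thesis using pos by (intro hit[of 1 1]) (simp_all add: base_drawing_def on_xi_def on_eta_def)
    next
      assume "R = Rect 14 24 8 14"
      then show ?thesis using pos by (intro hit[of 2 1]) (simp_all add: base_drawing_def on_xi_def on_eta_def)
    next
      assume R: "R = Rect 22 30 2 12"
      obtain l where "l < 2" "0 < w 3 l"
        using pos(8) by (metis one_less_numeral_iff pos2 semiring_norm(76))
      moreover from this have "l = 0 \<or> l = 1" by auto
      then have "on_eta base_drawing l R" by (auto simp: R base_drawing_def on_eta_def)
      ultimately show ?thesis by (intro hit[of 3 l]) (simp_all add: R base_drawing_def on_xi_def)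
    next
      assume "R = Rect 6 24 0 4"
      then show ?thesis using pos by (intro hit[of 2 0]) (simp_all add: base_drawing_def on_xi_def on_eta_def)
    qed
  qed
  then show ?thesis
    using assms(1,2) by (simp add: covering_weights_def num sum_less_4)
qed

lemma covering_weights_base: "\<exists>w. covering_weights base_drawing \<epsilon> \<delta> w"
proof -
  \<comment> \<open>One table for each choice of the two patterns; its rows belong to the vertical markers and
  its columns to the horizontal ones.\<close>
  define w1 w2 w3 w4 :: "nat \<Rightarrow> nat \<Rightarrow> nat" where
    "w1 k l = [[1, 0, 0, 2], [0, 1, 1, 0], [1, 1, 0, 0], [1, 0, 1, 1]] ! k ! l" and
    "w2 k l = [[1, 0, 0, 2], [0, 1, 1, 0], [1, 1, 0, 0], [0, 1, 2, 0]] ! k ! l" and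
    "w3 k l = [[1, 0, 0, 1], [0, 1, 1, 1], [1, 1, 0, 1], [1, 0, 1, 0]] ! k ! l" and
    "w4 k l = [[1, 0, 0, 1], [0, 1, 1, 1], [1, 1, 1, 0], [0, 1, 1, 0]] ! k ! l" for k l
  consider "\<epsilon> 0" "\<delta> 0" | "\<epsilon> 0" "\<not> \<delta> 0" | "\<not> \<epsilon> 0" "\<delta> 0" | "\<not> \<epsilon> 0" "\<not> \<delta> 0" by blast
  then show ?thesis
  proof cases
    case 1
    have "covering_weights base_drawing \<epsilon> \<delta> w1"
      by (rule covering_weights_baseI; unfold all_less_4 point_pattern_first w1_def; simp add: 1)
    then show ?thesis by blast
  next
    case 2
    have "covering_weights base_drawing \<epsilon> \<delta> w2"
      by (rule covering_weights_baseI; unfold all_less_4 point_pattern_first w2_def; simp add: 2)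
    then show ?thesis by blast
  next
    case 3
    have "covering_weights base_drawing \<epsilon> \<delta> w3"
      by (rule covering_weights_baseI; unfold all_less_4 point_pattern_first w3_def; simp add: 3)
    then show ?thesis by blast
  next
    case 4
    have "covering_weights base_drawing \<epsilon> \<delta> w4"
      by (rule covering_weights_baseI; unfold all_less_4 point_pattern_first w4_def; simp add: 4)
    then show ?thesis by blast
  qed
qed

text \<open>The vertical-marker pattern of a system is chosen so that the \<open>i\<close>-th horizontal system has
  as many points on marker \<open>j\<close> as the \<open>j\<close>-th vertical system has on marker \<open>i\<close>. The horizontal-marker
  patterns are still free and become the patterns of the new drawing, because the points
  on the new marker \<open>(j, t)\<close> correspond to those of the \<open>j\<close>-th vertical system on \<open>t\<close>.\<close>

lemma covering_weights_crossbar: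
  assumes P: "integral_drawing P" and q4: "4 dvd num P"
    and cover: "\<And>\<epsilon> \<delta>. \<exists>w. covering_weights P \<epsilon> \<delta> w"
  shows "\<exists>w. covering_weights (crossbar P) \<epsilon> \<delta> w"
proof -
  let ?q = "num P"
  have "\<forall>i. \<exists>w. covering_weights P (\<lambda>_. outer i) (\<lambda>a. \<delta> (i * (?q div 4) + a)) w"
    using cover by blast
  from choice[OF this] obtain h
    where h: "\<And>i. covering_weights P (\<lambda>_. outer i) (\<lambda>a. \<delta> (i * (?q div 4) + a)) (h i)"
    by blast
  have "\<forall>j. \<exists>w. covering_weights P (\<lambda>_. outer j) (\<lambda>a. \<epsilon> (j * (?q div 4) + a)) w"
    using cover by blast
  from choice[OF this] obtain v
    where v: "\<And>j. covering_weights P (\<lambda>_. outer j) (\<lambda>a. \<epsilon> (j * (?q div 4) + a)) (v j)"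
    by blast
  have "\<exists>u. (\<forall>s<?q. (\<Sum>t<?q. u s t) = h i j s) \<and> (\<forall>t<?q. (\<Sum>s<?q. u s t) = v j i t)"
    if "i < ?q" "j < ?q" for i j
  proof (rule transport_plan)
    show "(\<Sum>s<?q. h i j s) = (\<Sum>t<?q. v j i t)"
      using h[of i] v[of j] that by (auto simp: covering_weights_def point_pattern_def)
  qed
  then obtain u where
    uh: "\<And>i j s. \<lbrakk>i < ?q; j < ?q; s < ?q\<rbrakk> \<Longrightarrow> (\<Sum>t<?q. u i j s t) = h i j s" and
    uv: "\<And>i j t. \<lbrakk>i < ?q; j < ?q; t < ?q\<rbrakk> \<Longrightarrow> (\<Sum>s<?q. u i j s t) = v j i t"
    by metis
  define w where "w k l = u (l div ?q) (k div ?q) (l mod ?q) (k mod ?q)" for k l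
  have split: "k div ?q < ?q" "k mod ?q < ?q" if "k < ?q * ?q" for k
    using marker_split[OF P that] by auto
  have join: "j * ?q + t < ?q * ?q" "(j * ?q + t) div ?q = j" "(j * ?q + t) mod ?q = t"
    if "j < ?q" "t < ?q" for j t
  proof -
    have "j * ?q + t < Suc j * ?q" using that by simp
    also have "\<dots> \<le> ?q * ?q" using that by (intro mult_le_mono1) auto
    finally show "j * ?q + t < ?q * ?q" .
  qed (use that in auto)
  have blk: "point_pattern \<zeta> k = point_pattern (\<lambda>a. \<zeta> ((k div ?q) * (?q div 4) + a)) (k mod ?q)" for \<zeta> k
    using point_pattern_block[OF q4, of \<zeta> "k div ?q" "k mod ?q"] by simp
  have "(\<Sum>l<?q * ?q. w k l) = point_pattern \<epsilon> k" if k: "k < ?q * ?q" for k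
  proof -
    have "(\<Sum>l<?q * ?q. w k l) = (\<Sum>i<?q. \<Sum>s<?q. u i (k div ?q) s (k mod ?q))"
      unfolding w_def by (rule sum_digits)
    also have "\<dots> = (\<Sum>i<?q. v (k div ?q) i (k mod ?q))"
      using uv split[OF k] by simp
    also have "\<dots> = point_pattern \<epsilon> k"
      using v[of "k div ?q"] split[OF k] by (simp add: covering_weights_def blk[of \<epsilon> k])
    finally show ?thesis .
  qed
  moreover have "(\<Sum>k<?q * ?q. w k l) = point_pattern \<delta> l" if l: "l < ?q * ?q" for l
  proof -
    have "(\<Sum>k<?q * ?q. w k l) = (\<Sum>j<?q. \<Sum>t<?q. u (l div ?q) j (l mod ?q) t)"
      unfolding w_def by (rule sum_digits)
    also have "\<dots> = (\<Sum>j<?q. h (l div ?q) j (l mod ?q))"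
      using uh split[OF l] by simp
    also have "\<dots> = point_pattern \<delta> l"
      using h[of "l div ?q"] split[OF l] by (simp add: covering_weights_def blk[of \<delta> l])
    finally show ?thesis .
  qed
  moreover have "\<exists>k<?q * ?q. \<exists>l<?q * ?q. 0 < w k l \<and> on_xi (crossbar P) k B \<and> on_eta (crossbar P) l B"
    if "B \<in> rects (crossbar P)" for B
  proof -
    from that obtain i R where R: "i < ?q" "R \<in> rects P"
      and B: "B = horizontal_copy P i R \<or> B = vertical_copy P i R"
      by (auto simp: rects_crossbar bars_def)
    show ?thesis
    proof (cases "B = horizontal_copy P i R")
      case True
      obtain j s where js: "j < ?q" "s < ?q" "0 < h i j s" "on_xi P j R" "on_eta P s R"
        using h[of i] R by (auto simp: covering_weights_def)
      then have "0 < (\<Sum>t<?q. u i j s t)" using uh R by simp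
      then obtain t where t: "t < ?q" "0 < u i j s t"
        by (metis gr0I lessThan_iff less_irrefl sum.neutral)
      show ?thesis
      proof (intro exI conjI)
        show "j * ?q + t < ?q * ?q" "i * ?q + s < ?q * ?q" using join js t R by auto
        show "0 < w (j * ?q + t) (i * ?q + s)" using join js t R by (simp add: w_def)
        show "on_xi (crossbar P) (j * ?q + t) B" "on_eta (crossbar P) (i * ?q + s) B"
          using join js t R by (simp_all add: True on_xi_horizontal[OF P] on_eta_horizontal[OF P])
      qed
    next
      case False
      then have V: "B = vertical_copy P i R" using B by simp
      obtain l t where lt: "l < ?q" "t < ?q" "0 < v i l t" "on_xi P l R" "on_eta P t R"
        using v[of i] R by (auto simp: covering_weights_def)
      then have "0 < (\<Sum>s<?q. u l i s t)" using uv R by simp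
      then obtain s where s: "s < ?q" "0 < u l i s t"
        by (metis gr0I lessThan_iff less_irrefl sum.neutral)
      show ?thesis
      proof (intro exI conjI)
        show "i * ?q + t < ?q * ?q" "l * ?q + s < ?q * ?q" using join lt s R by auto
        show "0 < w (i * ?q + t) (l * ?q + s)" using join lt s R by (simp add: w_def)
        show "on_xi (crossbar P) (i * ?q + t) B" "on_eta (crossbar P) (l * ?q + s) B"
          using join lt s R by (simp_all add: V on_xi_vertical[OF P] on_eta_vertical[OF P])
      qed
    qed
  qed
  ultimately have "covering_weights (crossbar P) \<epsilon> \<delta> w"
    unfolding covering_weights_def by simp
  then show ?thesis by blast
qed

lemma covering_weights_drawing_seq: "\<exists>w. covering_weights (drawing_seq r) \<epsilon> \<delta> w"
proof (induction r arbitrary: \<epsilon> \<delta>)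
  case 0
  show ?case using covering_weights_base by (simp add: drawing_seq_0)
next
  case (Suc r)
  have "4 dvd num (drawing_seq r)"
    unfolding num_drawing_seq by (rule dvd_power) simp
  then show ?case
    unfolding drawing_seq_Suc using Suc by (intro covering_weights_crossbar drawing_seq_integral)
qed

lemma small_piercing_set:
  "\<exists>X. finite X \<and> 2 * card X \<le> 5 * 4 ^ 2 ^ r \<and> (\<forall>R\<in>rect_family r. region R \<inter> X \<noteq> {})"
proof -
  let ?P = "drawing_seq r"
  let ?q = "num ?P"
  obtain w where w: "covering_weights ?P (\<lambda>_. True) (\<lambda>_. True) w"
    using covering_weights_drawing_seq by blast
  define K where "K = {(k, l) \<in> {..<?q} \<times> {..<?q}. 0 < w k l}"
  define X where "X = (\<lambda>(k, l). (xi ?P k, eta ?P l)) ` K"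
  have fin: "finite K" unfolding K_def by (rule finite_subset[of _ "{..<?q} \<times> {..<?q}"]) auto
  have "4 dvd ?q" unfolding num_drawing_seq by (rule dvd_power) simp
  then obtain m where m: "?q = 4 * m" by blast
  have "card X \<le> card K" unfolding X_def by (rule card_image_le[OF fin])
  also have "card K = (\<Sum>(k, l)\<in>K. 1)" by simp
  also have "\<dots> \<le> (\<Sum>(k, l)\<in>K. w k l)"
    by (intro sum_mono) (auto simp: K_def)
  also have "\<dots> \<le> (\<Sum>(k, l)\<in>{..<?q} \<times> {..<?q}. w k l)"
    by (intro sum_mono2) (auto simp: K_def)
  also have "\<dots> = (\<Sum>k<?q. \<Sum>l<?q. w k l)" by (simp add: sum.cartesian_product)
  also have "\<dots> = (\<Sum>k<?q. point_pattern (\<lambda>_. True) k)" using w by (simp add: covering_weights_def)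
  also have "\<dots> = 10 * m" unfolding m by (rule sum_point_pattern)
  finally have "2 * card X \<le> 5 * ?q" by (simp add: m)
  moreover have "region R \<inter> X \<noteq> {}" if R: "R \<in> rect_family r" for R
  proof -
    obtain k l where kl: "k < ?q" "l < ?q" "0 < w k l" "on_xi ?P k R" "on_eta ?P l R"
      using w R by (auto simp: covering_weights_def rect_family_def)
    then have "(xi ?P k, eta ?P l) \<in> region R \<inter> X"
      by (auto simp: region_def on_xi_def on_eta_def X_def K_def)
    then show ?thesis by blast
  qed
  ultimately show ?thesis
    using fin by (intro exI[of _ X]) (simp add: X_def num_drawing_seq)
qed

lemma piercing_number_le: "2 * piercing_number (rect_family r) \<le> 5 * 4 ^ 2 ^ r"
proof -
  obtain X where X: "finite X" "2 * card X \<le> 5 * 4 ^ 2 ^ r" "\<forall>R\<in>rect_family r. region R \<inter> X \<noteq> {}"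
    using small_piercing_set by blast
  have "piercing_number (rect_family r) \<le> card X"
    unfolding piercing_number_def by (rule Least_le) (use X in blast)
  then show ?thesis using X by simp
qed

section \<open>Duality between piercing and clique relaxation\<close>

lemma clique_iff_pairwise_meets:
  assumes "K \<subseteq> F"
  shows "clique K (intersection_edges F) \<longleftrightarrow> pairwise meets K"
proof -
  have sym: "meets R S \<longleftrightarrow> meets S R" for R S by (auto simp: meets_def)
  show ?thesis
    unfolding clique_def pairwise_def intersection_edges_def
    using assms by (auto simp: doubleton_eq_iff simp flip: meets_def) (blast dest: sym[THEN iffD1])+
qed

text \<open>Weak duality: the rectangles through a piercing point form a clique, and these cliques
  cover the family.\<close>

lemma clique_sum_le_pierce:
  fixes x :: "rect \<Rightarrow> real"
  assumes F: "finite F" and X: "finite X" "\<forall>R\<in>F. region R \<inter> X \<noteq> {}"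
    and x: "\<forall>R\<in>F. 0 \<le> x R" "\<forall>K. K \<subseteq> F \<and> clique K (intersection_edges F) \<longrightarrow> (\<Sum>R\<in>K. x R) \<le> 1"
  shows "(\<Sum>R\<in>F. x R) \<le> card X"
proof -
  have "(\<Sum>R\<in>F. x R) \<le> (\<Sum>R\<in>F. \<Sum>p\<in>X. of_bool (p \<in> region R) * x R)"
  proof (rule sum_mono)
    fix R assume R: "R \<in> F"
    then obtain p where p: "p \<in> X" "p \<in> region R" using X by blast
    have "of_bool (p \<in> region R) * x R \<le> (\<Sum>p\<in>X. of_bool (p \<in> region R) * x R)"
      using X(1) p(1) x(1) R by (intro member_le_sum) auto
    then show "x R \<le> (\<Sum>p\<in>X. of_bool (p \<in> region R) * x R)" using p by simp
  qed
  also have "\<dots> = (\<Sum>p\<in>X. \<Sum>R\<in>F. of_bool (p \<in> region R) * x R)" by (rule sum.swap)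
  also have "\<dots> = (\<Sum>p\<in>X. \<Sum>R\<in>{R \<in> F. p \<in> region R}. x R)"
    by (intro sum.cong refl sum.mono_neutral_cong_right F) auto
  also have "\<dots> \<le> (\<Sum>p\<in>X. 1)"
  proof (rule sum_mono)
    fix p assume "p \<in> X"
    have "pairwise meets {R \<in> F. p \<in> region R}"
      by (auto simp: pairwise_def meets_def)
    then show "(\<Sum>R\<in>{R \<in> F. p \<in> region R}. x R) \<le> 1"
      using x(2) clique_iff_pairwise_meets[of "{R \<in> F. p \<in> region R}" F] by auto
  qed
  finally show ?thesis by simp
qed

text \<open>The piercing set \<open>X\<close> bounds the values over which the supremum is taken. A family without
  large cliques gives a lower bound by spreading equal weights over it.\<close>

lemma alpha_star_bounds:
  assumes F: "finite F" and X: "finite X" "\<forall>R\<in>F. region R \<inter> X \<noteq> {}"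
  shows alpha_star_le_piercing: "alpha_star F \<le> piercing_number F"
    and alpha_star_ge: "\<And>A a. \<lbrakk>A \<subseteq> F; 0 < a; \<And>K. \<lbrakk>K \<subseteq> A; pairwise meets K\<rbrakk> \<Longrightarrow> real (card K) \<le> a\<rbrakk>
      \<Longrightarrow> card A / a \<le> alpha_star F"
proof -
  let ?E = "intersection_edges F"
  let ?V = "{\<Sum>v\<in>F. x v | x :: rect \<Rightarrow> real.
            (\<forall>v\<in>F. 0 \<le> x v) \<and> (\<forall>K. K \<subseteq> F \<and> clique K ?E \<longrightarrow> (\<Sum>v\<in>K. x v) \<le> 1)}"
  have eq: "alpha_star F = Sup ?V" by (simp add: alpha_star_def clique_relaxation_def)
  have "\<exists>X. finite X \<and> card X = piercing_number F \<and> (\<forall>R\<in>F. region R \<inter> X \<noteq> {})"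
    unfolding piercing_number_def by (rule LeastI_ex) (use X in blast)
  then obtain Y where Y: "finite Y" "card Y = piercing_number F" "\<forall>R\<in>F. region R \<inter> Y \<noteq> {}" by blast
  have up: "v \<le> piercing_number F" if "v \<in> ?V" for v
    using that clique_sum_le_pierce[OF F Y(1,3)] Y(2) by auto
  have "(\<Sum>v\<in>F. 0::real) \<in> ?V" by (intro CollectI exI[of _ "\<lambda>_. 0"]) simp
  then have "?V \<noteq> {}" by blast
  then show "alpha_star F \<le> piercing_number F"
    unfolding eq by (rule cSup_least) (rule up)
  have bdd: "bdd_above ?V" by (rule bdd_aboveI) (rule up)
  fix A a assume A: "A \<subseteq> F" "0 < (a::real)"
    and a: "\<And>K. \<lbrakk>K \<subseteq> A; pairwise meets K\<rbrakk> \<Longrightarrow> real (card K) \<le> a"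
  define x where "x R = (if R \<in> A then 1 / a else 0)" for R
  have sum_x: "(\<Sum>R\<in>K. x R) = card (K \<inter> A) / a" if "K \<subseteq> F" for K
    using finite_subset[OF that F] by (simp add: x_def sum.If_cases Int_def)
  have "(\<Sum>R\<in>F. x R) \<in> ?V"
  proof (intro CollectI exI[of _ x] conjI refl allI impI ballI)
    show "0 \<le> x v" for v using A by (simp add: x_def)
    fix K assume K: "K \<subseteq> F \<and> clique K ?E"
    then have "pairwise meets (K \<inter> A)"
      using clique_iff_pairwise_meets[of K F] by (auto intro: pairwise_subset)
    then have "real (card (K \<inter> A)) \<le> a" by (intro a) auto
    then show "(\<Sum>R\<in>K. x R) \<le> 1" using K A by (simp add: sum_x)
  qed
  then have "(\<Sum>R\<in>F. x R) \<le> alpha_star F" unfolding eq using bdd by (rule cSup_upper)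
  then show "card A / a \<le> alpha_star F"
    using sum_x[of F] A by (simp add: Int_absorb1)
qed

section \<open>Clique sizes under thinned crossbar steps\<close>

text \<open>The crossing law couples cliques of different kinds, so three bounds have to be carried
  along: \<open>a\<close> for arbitrary cliques, \<open>g\<close> for cliques crossed by one marker from \<open>G\<close>, vertical
  or horizontal, and \<open>c\<close> for cliques crossed by one marker from \<open>G\<close> in each direction.\<close>

definition clique_bounds ::
  "drawing \<Rightarrow> nat set \<Rightarrow> rect set \<Rightarrow> real \<Rightarrow> real \<Rightarrow> real \<Rightarrow> bool" where
  "clique_bounds P G A a g c \<longleftrightarrow> (\<forall>K\<subseteq>A. pairwise meets K \<longrightarrow>
     real (card K) \<le> a \<and>
     (\<forall>k\<in>G. (\<forall>R\<in>K. on_xi P k R) \<or> (\<forall>R\<in>K. on_eta P k R) \<longrightarrow> real (card K) \<le> g) \<and>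
     (\<forall>k\<in>G. \<forall>l\<in>G. (\<forall>R\<in>K. on_xi P k R \<and> on_eta P l R) \<longrightarrow> real (card K) \<le> c))"

lemma clique_bounds_mono:
  assumes "clique_bounds P G A a g c" "G' \<subseteq> G" "a \<le> a'" "g \<le> g'" "c \<le> c'"
  shows "clique_bounds P G' A a' g' c'"
  using assms unfolding clique_bounds_def by (meson order_trans subsetD)

text \<open>A clique lies in one horizontal and one vertical system. If it has parts \<open>X\<close> and \<open>Y\<close> in both,
  the crossing law puts all of \<open>X\<close> on the marker \<open>j\<close> and all of \<open>Y\<close> on the marker \<open>i\<close>.\<close>

lemma clique_in_bars:
  assumes P: "integral_drawing P" and G: "G \<subseteq> {..<num P}" and A: "A \<subseteq> rects P"
    and K: "K \<subseteq> bars P G A" "pairwise meets K"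
  obtains i j X Y where "K = horizontal_copy P i ` X \<union> vertical_copy P j ` Y" "X \<subseteq> A" "Y \<subseteq> A"
    "X \<noteq> {} \<Longrightarrow> i \<in> G" "Y \<noteq> {} \<Longrightarrow> j \<in> G" "pairwise meets X" "pairwise meets Y"
    "\<And>R S. \<lbrakk>R \<in> X; S \<in> Y\<rbrakk> \<Longrightarrow> on_xi P j R \<and> on_xi P i S"
proof -
  have lt: "i < num P" if "i \<in> G" for i using that G by auto
  have rA: "R \<in> rects P" if "R \<in> A" for R using that A by auto
  have mK: "meets B B'" if "B \<in> K" "B' \<in> K" "B \<noteq> B'" for B B'
    using that K(2) unfolding pairwise_def by blast
  have H: "i = i' \<and> (R = R' \<or> meets R R')"
    if "i \<in> G" "i' \<in> G" "R \<in> A" "R' \<in> A" "horizontal_copy P i R \<in> K" "horizontal_copy P i' R' \<in> K"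
    for i i' R R'
    using mK[OF that(5,6)] meets_horizontal[OF P rA[OF that(3)] rA[OF that(4)] lt[OF that(1)] lt[OF that(2)]]
      horizontal_eq_iff[OF P rA[OF that(3)] rA[OF that(4)] lt[OF that(1)] lt[OF that(2)]] by blast
  have V: "i = i' \<and> (R = R' \<or> meets R R')"
    if "i \<in> G" "i' \<in> G" "R \<in> A" "R' \<in> A" "vertical_copy P i R \<in> K" "vertical_copy P i' R' \<in> K"
    for i i' R R'
    using mK[OF that(5,6)] meets_vertical[OF P rA[OF that(3)] rA[OF that(4)] lt[OF that(1)] lt[OF that(2)]]
      vertical_eq_iff[OF P rA[OF that(3)] rA[OF that(4)] lt[OF that(1)] lt[OF that(2)]] by blast
  have HV: "on_xi P j R \<and> on_xi P i S"
    if "i \<in> G" "j \<in> G" "R \<in> A" "S \<in> A" "horizontal_copy P i R \<in> K" "vertical_copy P j S \<in> K"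
    for i j R S
    using mK[OF that(5,6)] meets_horizontal_vertical[OF P rA[OF that(3)] rA[OF that(4)] lt[OF that(1)] lt[OF that(2)]]
      horizontal_neq_vertical[OF P rA[OF that(3)] rA[OF that(4)] lt[OF that(1)] lt[OF that(2)]] by blast
  obtain i where i: "\<And>i' R. \<lbrakk>i' \<in> G; R \<in> A; horizontal_copy P i' R \<in> K\<rbrakk> \<Longrightarrow> i' = i"
  proof (cases "\<exists>i\<in>G. \<exists>R\<in>A. horizontal_copy P i R \<in> K")
    case True
    then obtain i R where "i \<in> G" "R \<in> A" "horizontal_copy P i R \<in> K" by blast
    then show thesis using H by (intro that[of i]) blast
  qed (use that in blast)
  obtain j where j: "\<And>j' R. \<lbrakk>j' \<in> G; R \<in> A; vertical_copy P j' R \<in> K\<rbrakk> \<Longrightarrow> j' = j"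
  proof (cases "\<exists>j\<in>G. \<exists>R\<in>A. vertical_copy P j R \<in> K")
    case True
    then obtain j R where "j \<in> G" "R \<in> A" "vertical_copy P j R \<in> K" by blast
    then show thesis using V by (intro that[of j]) blast
  qed (use that in blast)
  define X where "X = {R \<in> A. i \<in> G \<and> horizontal_copy P i R \<in> K}"
  define Y where "Y = {R \<in> A. j \<in> G \<and> vertical_copy P j R \<in> K}"
  show thesis
  proof (rule that[of i X j Y])
    show "K = horizontal_copy P i ` X \<union> vertical_copy P j ` Y"
    proof (intro equalityI subsetI)
      fix B assume B: "B \<in> K"
      then obtain k R where kR: "k \<in> G" "R \<in> A" "B = horizontal_copy P k R \<or> B = vertical_copy P k R"
        using K(1) unfolding bars_def by blast
      then show "B \<in> horizontal_copy P i ` X \<union> vertical_copy P j ` Y"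
        using i j B unfolding X_def Y_def by blast
    qed (auto simp: X_def Y_def)
    show "pairwise meets X" "pairwise meets Y"
      using H V unfolding X_def Y_def pairwise_def by blast+
    show "on_xi P j R \<and> on_xi P i S" if "R \<in> X" "S \<in> Y" for R S
      using that HV unfolding X_def Y_def by blast
  qed (auto simp: X_def Y_def)
qed

text \<open>The markers of the crossbar both of whose digits lie in \<open>G\<close>.\<close>

definition marker_square :: "nat \<Rightarrow> nat set \<Rightarrow> nat set" where
  "marker_square q G = {k. k < q * q \<and> k div q \<in> G \<and> k mod q \<in> G}"

lemma card_marker_square:
  assumes "G \<subseteq> {..<q}"
  shows "card (marker_square q G) = card G ^ 2"
proof -
  have "card (marker_square q G) = (\<Sum>j<q. card {t. t < q \<and> j \<in> G \<and> t \<in> G})"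
    unfolding marker_square_def by (rule card_digits)
  also have "\<dots> = (\<Sum>j<q. of_bool (j \<in> G) * card G)"
  proof (rule sum.cong[OF refl])
    fix j
    have "{t. t < q \<and> j \<in> G \<and> t \<in> G} = (if j \<in> G then G else {})" using assms by auto
    then show "card {t. t < q \<and> j \<in> G \<and> t \<in> G} = of_bool (j \<in> G) * card G" by simp
  qed
  also have "\<dots> = card G * card G"
  proof -
    have "{..<q} \<inter> {j. j \<in> G} = G" using assms by auto
    then have "(\<Sum>j<q. of_bool (j \<in> G)) = card G" by (subst sum_of_bool_eq) simp_all
    then show ?thesis by (simp flip: sum_distrib_right)
  qed
  finally show ?thesis by (simp add: power2_eq_square)
qed

text \<open>A clique with two parts has both of them on markers of \<open>G\<close>, hence size at most \<open>2 * g\<close>. If, moreover, a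
  marker \<open>(j', t)\<close> crosses the whole clique, its digit \<open>t\<close> puts one of the parts on a second
  marker, in the other direction, and the bound improves to \<open>g + c\<close>. With crossing markers
  in both directions this happens to both parts.\<close>

lemma clique_bounds_bars:
  assumes P: "integral_drawing P" and G: "G \<subseteq> {..<num P}" and A: "A \<subseteq> rects P"
    and bounds: "clique_bounds P G A a g c"
  shows "clique_bounds (crossbar P) (marker_square (num P) G) (bars P G A) (max a (2 * g)) (g + c) (2 * c)"
  unfolding clique_bounds_def
proof (intro allI impI)
  fix K assume K: "K \<subseteq> bars P G A" "pairwise meets K"
  obtain i j X Y where eq: "K = horizontal_copy P i ` X \<union> vertical_copy P j ` Y" and XY: "X \<subseteq> A" "Y \<subseteq> A"
    and iG: "X \<noteq> {} \<Longrightarrow> i \<in> G" and jG: "Y \<noteq> {} \<Longrightarrow> j \<in> G" and mXY: "pairwise meets X" "pairwise meets Y"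
    and cross: "\<And>R S. \<lbrakk>R \<in> X; S \<in> Y\<rbrakk> \<Longrightarrow> on_xi P j R \<and> on_xi P i S"
    using clique_in_bars[OF P G A K] by metis
  have fin: "finite X" "finite Y" using XY A finite_rects[OF P] by (meson finite_subset order_trans)+
  have "card K \<le> card (horizontal_copy P i ` X) + card (vertical_copy P j ` Y)"
    unfolding eq by (rule card_Un_le)
  also have "\<dots> \<le> card X + card Y" using fin by (intro add_mono card_image_le)
  finally have card_K: "real (card K) \<le> real (card X) + real (card Y)" by linarith
  have any: "real (card Z) \<le> a" if "Z \<subseteq> A" "pairwise meets Z" for Z
    using bounds that unfolding clique_bounds_def by blast
  have line: "real (card Z) \<le> g"
    if "Z \<subseteq> A" "pairwise meets Z" "k \<in> G" "(\<forall>R\<in>Z. on_xi P k R) \<or> (\<forall>R\<in>Z. on_eta P k R)" for Z k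
    using bounds that unfolding clique_bounds_def by blast
  have both: "real (card Z) \<le> c"
    if "Z \<subseteq> A" "pairwise meets Z" "k \<in> G" "l \<in> G" "\<forall>R\<in>Z. on_xi P k R \<and> on_eta P l R" for Z k l
    using bounds that unfolding clique_bounds_def by blast
  have rX: "R \<in> rects P" if "R \<in> X" for R using that XY A by auto
  have rY: "R \<in> rects P" if "R \<in> Y" for R using that XY A by auto
  have iq: "i < num P" if "R \<in> X" for R using that iG G by auto
  have jq: "j < num P" if "R \<in> Y" for R using that jG G by auto
  have hX: "horizontal_copy P i R \<in> K" if "R \<in> X" for R using that by (simp add: eq)
  have vY: "vertical_copy P j R \<in> K" if "R \<in> Y" for R using that by (simp add: eq)
  let ?q = "num P"
  show "real (card K) \<le> max a (2 * g) \<and>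
     (\<forall>k\<in>marker_square ?q G. (\<forall>R\<in>K. on_xi (crossbar P) k R) \<or> (\<forall>R\<in>K. on_eta (crossbar P) k R)
        \<longrightarrow> real (card K) \<le> g + c) \<and>
     (\<forall>k\<in>marker_square ?q G. \<forall>l\<in>marker_square ?q G.
        (\<forall>R\<in>K. on_xi (crossbar P) k R \<and> on_eta (crossbar P) l R) \<longrightarrow> real (card K) \<le> 2 * c)"
  proof (intro conjI ballI impI)
    show "real (card K) \<le> max a (2 * g)"
    proof (cases "X = {} \<or> Y = {}")
      case True
      then show ?thesis using any[OF XY(1) mXY(1)] any[OF XY(2) mXY(2)] card_K by auto
    next
      case False
      then have "real (card X) \<le> g" "real (card Y) \<le> g"
        using cross iG jG by (intro line[OF XY(1) mXY(1), of j] line[OF XY(2) mXY(2), of i]; blast)+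
      then show ?thesis using card_K by simp
    qed
  next
    fix k assume k: "k \<in> marker_square ?q G"
      and on: "(\<forall>R\<in>K. on_xi (crossbar P) k R) \<or> (\<forall>R\<in>K. on_eta (crossbar P) k R)"
    have k': "k < ?q * ?q" "k div ?q \<in> G" "k mod ?q \<in> G" using k by (auto simp: marker_square_def)
    have g0: "0 \<le> c" using both[of "{}" "k div ?q" "k div ?q"] k' by simp
    from on show "real (card K) \<le> g + c"
    proof
      assume on: "\<forall>R\<in>K. on_xi (crossbar P) k R"
      have X: "on_xi P (k div ?q) R" if "R \<in> X" for R
        using on_xi_horizontal[OF P rX[OF that] iq[OF that] k'(1)] on hX[OF that] by blast
      have Y: "on_eta P (k mod ?q) R" if "R \<in> Y" for R
        using on_xi_vertical[OF P rY[OF that] jq[OF that] k'(1)] on vY[OF that] by blast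
      show ?thesis
      proof (cases "X = {}")
        case True
        then show ?thesis
          using line[OF XY(2) mXY(2) k'(3)] Y card_K g0 by fastforce
      next
        case False
        then have "real (card Y) \<le> c" using Y cross iG k' by (intro both[OF XY(2) mXY(2), of i "k mod ?q"]) blast+
        moreover have "real (card X) \<le> g" using line[OF XY(1) mXY(1) k'(2)] X by blast
        ultimately show ?thesis using card_K by simp
      qed
    next
      assume on: "\<forall>R\<in>K. on_eta (crossbar P) k R"
      have X: "on_eta P (k mod ?q) R" if "R \<in> X" for R
        using on_eta_horizontal[OF P rX[OF that] iq[OF that] k'(1)] on hX[OF that] by blast
      have Y: "on_xi P (k div ?q) R" if "R \<in> Y" for R
        using on_eta_vertical[OF P rY[OF that] jq[OF that] k'(1)] on vY[OF that] by blast
      show ?thesis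
      proof (cases "Y = {}")
        case True
        then show ?thesis
          using line[OF XY(1) mXY(1) k'(3)] X card_K g0 by fastforce
      next
        case False
        then have "real (card X) \<le> c" using X cross jG k' by (intro both[OF XY(1) mXY(1), of j "k mod ?q"]) blast+
        moreover have "real (card Y) \<le> g" using line[OF XY(2) mXY(2) k'(2)] Y by blast
        ultimately show ?thesis using card_K by simp
      qed
    qed
  next
    fix k l assume k: "k \<in> marker_square ?q G" and l: "l \<in> marker_square ?q G"
      and on: "\<forall>R\<in>K. on_xi (crossbar P) k R \<and> on_eta (crossbar P) l R"
    have k': "k < ?q * ?q" "k div ?q \<in> G" "k mod ?q \<in> G" using k by (auto simp: marker_square_def)
    have l': "l < ?q * ?q" "l div ?q \<in> G" "l mod ?q \<in> G" using l by (auto simp: marker_square_def)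
    have "on_xi P (k div ?q) R \<and> on_eta P (l mod ?q) R" if "R \<in> X" for R
      using on_xi_horizontal[OF P rX[OF that] iq[OF that] k'(1)]
        on_eta_horizontal[OF P rX[OF that] iq[OF that] l'(1)] on hX[OF that] by blast
    then have "real (card X) \<le> c" using both[OF XY(1) mXY(1) k'(2) l'(3)] by blast
    moreover have "on_xi P (l div ?q) R \<and> on_eta P (k mod ?q) R" if "R \<in> Y" for R
      using on_xi_vertical[OF P rY[OF that] jq[OF that] k'(1)]
        on_eta_vertical[OF P rY[OF that] jq[OF that] l'(1)] on vY[OF that] by blast
    then have "real (card Y) \<le> c" using both[OF XY(2) mXY(2) l'(2) k'(3)] by blast
    ultimately show "real (card K) \<le> 2 * c" using card_K by simp
  qed
qed

lemma bars_subset: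
  assumes "G \<subseteq> {..<num P}" "A \<subseteq> rects P"
  shows "bars P G A \<subseteq> rects (crossbar P)"
  using assms unfolding rects_crossbar bars_def by blast

text \<open>Under the recursion of the three bounds only \<open>c\<close> doubles in each step, while \<open>g\<close> grows by
  multiples of \<open>c\<close> and \<open>a\<close> follows \<open>2 * g\<close>. The initial \<open>a\<close> and \<open>g\<close> therefore become
  negligible compared with \<open>2 ^ d * c\<close>.\<close>

lemma iterated_thinning:
  assumes G: "G \<subseteq> {..<num (drawing_seq r)}" and A: "A \<subseteq> rects (drawing_seq r)"
    and bounds: "clique_bounds (drawing_seq r) G A a g c" and c: "0 \<le> c"
  shows "\<exists>G' A'. G' \<subseteq> {..<num (drawing_seq (r + d))} \<and> A' \<subseteq> rects (drawing_seq (r + d)) \<and>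
    card G' = card G ^ 2 ^ d \<and> card A' = 2 ^ d * card G ^ (2 ^ d - 1) * card A \<and>
    clique_bounds (drawing_seq (r + d)) G' A' (max a (2 * g + 2 ^ d * c)) (g + (2 ^ d - 1) * c) (2 ^ d * c)"
proof (induction d)
  case 0
  have "clique_bounds (drawing_seq r) G A (max a (2 * g + c)) g c"
    using bounds by (rule clique_bounds_mono) auto
  then show ?case using G A by (intro exI[of _ G] exI[of _ A]) simp
next
  case (Suc d)
  let ?P = "drawing_seq (r + d)"
  obtain G' A' where G': "G' \<subseteq> {..<num ?P}" and A': "A' \<subseteq> rects ?P"
    and card: "card G' = card G ^ 2 ^ d" "card A' = 2 ^ d * card G ^ (2 ^ d - 1) * card A"
    and b: "clique_bounds ?P G' A' (max a (2 * g + 2 ^ d * c)) (g + (2 ^ d - 1) * c) (2 ^ d * c)"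
    using Suc.IH by blast
  have P: "integral_drawing ?P" by (rule drawing_seq_integral)
  have exp: "(2::nat) ^ d + (2 ^ d - 1) = 2 ^ Suc d - 1"
    by (simp add: algebra_simps)
  show ?case
  proof (intro exI conjI)
    show "marker_square (num ?P) G' \<subseteq> {..<num (drawing_seq (r + Suc d))}"
      by (auto simp: marker_square_def drawing_seq_Suc)
    show "bars ?P G' A' \<subseteq> rects (drawing_seq (r + Suc d))"
      using bars_subset[OF G' A'] by (simp add: drawing_seq_Suc)
    show "card (marker_square (num ?P) G') = card G ^ 2 ^ Suc d"
      using card_marker_square[OF G'] by (simp add: card mult.commute flip: power_mult)
    show "card (bars ?P G' A') = 2 ^ Suc d * card G ^ (2 ^ Suc d - 1) * card A"
      unfolding card_bars[OF P G' A'] card exp[symmetric] power_add by simp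
    have "2 * g + 2 ^ d * c \<le> 2 * g + 2 ^ Suc d * c" using c by simp
    moreover have "2 * (g + (2 ^ d - 1) * c) \<le> 2 * g + 2 ^ Suc d * c" using c by (simp add: algebra_simps)
    moreover have "max (max a u) v \<le> max a w" if "u \<le> w" "v \<le> w" for u v w :: real
      using that by (auto simp: le_max_iff_disj)
    ultimately have "max (max a (2 * g + 2 ^ d * c)) (2 * (g + (2 ^ d - 1) * c)) \<le> max a (2 * g + 2 ^ Suc d * c)"
      by blast
    then show "clique_bounds (drawing_seq (r + Suc d)) (marker_square (num ?P) G') (bars ?P G' A')
      (max a (2 * g + 2 ^ Suc d * c)) (g + (2 ^ Suc d - 1) * c) (2 ^ Suc d * c)"
      using clique_bounds_mono[OF clique_bounds_bars[OF P G' A' b] order_refl]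
      by (simp add: drawing_seq_Suc algebra_simps)
  qed
qed

section \<open>The bars descending from the five-cycle\<close>

definition base_cycle :: "rect set" where
  "base_cycle = {Rect 0 8 2 10, Rect 6 16 8 14, Rect 14 24 8 14, Rect 22 30 2 12, Rect 6 24 0 4}"

primrec cycle_rects :: "nat \<Rightarrow> rect set" where
  "cycle_rects 0 = base_cycle"
| "cycle_rects (Suc r) = bars (drawing_seq r) {..<num (drawing_seq r)} (cycle_rects r)"

lemma cycle_rects_subset: "cycle_rects r \<subseteq> rects (drawing_seq r)"
proof (induction r)
  case 0
  show ?case by (simp add: drawing_seq_0 base_drawing_def base_cycle_def)
next
  case (Suc r)
  then show ?case by (simp add: drawing_seq_Suc bars_subset)
qed

lemma card_cycle_rects: "4 * card (cycle_rects r) = 5 * 2 ^ r * 4 ^ 2 ^ r"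
proof (induction r)
  case 0
  have "card base_cycle = 5" by (simp add: base_cycle_def)
  then show ?case by simp
next
  case (Suc r)
  have "card (cycle_rects (Suc r)) = 2 * num (drawing_seq r) * card (cycle_rects r)"
    by (simp only: cycle_rects.simps card_lessThan
        card_bars[OF drawing_seq_integral order_refl cycle_rects_subset])
  then have "4 * card (cycle_rects (Suc r)) = 2 * 4 ^ 2 ^ r * (4 * card (cycle_rects r))"
    by (simp add: num_drawing_seq del: cycle_rects.simps)
  also have "\<dots> = 5 * 2 ^ Suc r * (4 ^ 2 ^ r * 4 ^ 2 ^ r)" unfolding Suc by simp
  also have "(4::nat) ^ 2 ^ r * 4 ^ 2 ^ r = 4 ^ 2 ^ Suc r" by (simp add: mult_2 flip: power_add)
  finally show ?case .
qed

text \<open>A marker of \<open>P\<^sub>r\<close> unfolds into \<open>2 ^ r\<close> markers of the base drawing, alternately vertical and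
  horizontal ones for \<open>r > 0\<close>. The load counts the horizontal ones among the two lowest, the only horizontal ones
  that cross the five-cycle. The truth value tells whether the marker itself is regarded
  as horizontal; this matters only for \<open>r = 0\<close>.\<close>

fun cycle_load :: "bool \<Rightarrow> nat \<Rightarrow> nat \<Rightarrow> nat" where
  "cycle_load b 0 k = of_bool (b \<and> k < 2)"
| "cycle_load b (Suc r) k = cycle_load False r (k div 4 ^ 2 ^ r) + cycle_load True r (k mod 4 ^ 2 ^ r)"

text \<open>Each crossing of markers lies in at most one rectangle of the cycle, and in none on the two upper
  horizontal markers.\<close>

lemma base_cycle_crossing:
  assumes "k < 4" "l < 4"
  shows "card {R \<in> base_cycle. on_xi base_drawing k R \<and> on_eta base_drawing l R} \<le> of_bool (l < 2)"
proof -
  have k: "xi base_drawing k = 3 \<or> xi base_drawing k = 11 \<or> xi base_drawing k = 19 \<or> xi base_drawing k = 27"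
    using assms(1) by (auto simp: base_drawing_def numeral_eq_Suc less_Suc_eq)
  have l: "l < 2 \<and> (eta base_drawing l = 3 \<or> eta base_drawing l = 11)
    \<or> \<not> l < 2 \<and> (eta base_drawing l = 21 \<or> eta base_drawing l = 27)"
    using assms(2) by (auto simp: base_drawing_def numeral_eq_Suc less_Suc_eq)
  have eq: "card {R \<in> base_cycle. Q R} = (\<Sum>R\<in>base_cycle. of_bool (Q R))" for Q
    by (rule card_filter_eq_sum) (simp add: base_cycle_def)
  have "card {R \<in> base_cycle. on_xi base_drawing k R \<and> on_eta base_drawing l R} =
      (\<Sum>R\<in>base_cycle. of_bool (xmin R \<le> xi base_drawing k \<and> xi base_drawing k \<le> xmax R
        \<and> ymin R \<le> eta base_drawing l \<and> eta base_drawing l \<le> ymax R))"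
    unfolding eq on_xi_def on_eta_def by (simp add: conj_assoc)
  also have "\<dots> \<le> of_bool (l < 2)"
    using k l by (elim disjE conjE) (simp_all add: base_cycle_def)
  finally show ?thesis .
qed

text \<open>The rectangles through the crossing of \<open>(j, t)\<close> with \<open>(i, s)\<close> come from the crossings \<open>(j, s)\<close>
  and \<open>(i, t)\<close> of the smaller drawing, and the load adds up in the same way, only
  with the four terms grouped differently.\<close>

lemma card_crossing_le_load:
  assumes "k < num (drawing_seq r)" "l < num (drawing_seq r)"
  shows "card {R \<in> cycle_rects r. on_xi (drawing_seq r) k R \<and> on_eta (drawing_seq r) l R}
    \<le> cycle_load False r k + cycle_load True r l"
  using assms
proof (induction r arbitrary: k l)
  case 0
  then show ?case using base_cycle_crossing[of k l] by (simp add: drawing_seq_0 num_drawing_seq base_drawing_def)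
next
  case (Suc r)
  let ?P = "drawing_seq r"
  let ?q = "num ?P"
  have P: "integral_drawing ?P" by (rule drawing_seq_integral)
  have kl: "k < ?q * ?q" "l < ?q * ?q" using Suc.prems by (simp_all add: drawing_seq_Suc)
  note b = marker_split[OF P kl(1)] marker_split[OF P kl(2)]
  let ?X = "{R \<in> cycle_rects r. on_xi ?P (k div ?q) R \<and> on_eta ?P (l mod ?q) R}"
  let ?Y = "{R \<in> cycle_rects r. on_xi ?P (l div ?q) R \<and> on_eta ?P (k mod ?q) R}"
  have fin: "finite (cycle_rects r)"
    using cycle_rects_subset finite_rects[OF P] finite_subset by blast
  have rc: "R \<in> rects ?P" if "R \<in> cycle_rects r" for R using that cycle_rects_subset by blast
  have "{B \<in> cycle_rects (Suc r). on_xi (crossbar ?P) k B \<and> on_eta (crossbar ?P) l B}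
    \<subseteq> horizontal_copy ?P (l div ?q) ` ?X \<union> vertical_copy ?P (k div ?q) ` ?Y"
  proof (intro subsetI, elim CollectE conjE)
    fix B assume "B \<in> cycle_rects (Suc r)" and on: "on_xi (crossbar ?P) k B" "on_eta (crossbar ?P) l B"
    then obtain i R where iR: "i < ?q" "R \<in> cycle_rects r" "B = horizontal_copy ?P i R \<or> B = vertical_copy ?P i R"
      by (auto simp: bars_def)
    from iR(3) show "B \<in> horizontal_copy ?P (l div ?q) ` ?X \<union> vertical_copy ?P (k div ?q) ` ?Y"
    proof
      assume B: "B = horizontal_copy ?P i R"
      show ?thesis
        using on iR on_xi_horizontal[OF P rc iR(1) kl(1)] on_eta_horizontal[OF P rc iR(1) kl(2)]
        unfolding B by blast
    next
      assume B: "B = vertical_copy ?P i R"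
      show ?thesis
        using on iR on_xi_vertical[OF P rc iR(1) kl(1)] on_eta_vertical[OF P rc iR(1) kl(2)]
        unfolding B by blast
    qed
  qed
  then have "card {B \<in> cycle_rects (Suc r). on_xi (crossbar ?P) k B \<and> on_eta (crossbar ?P) l B}
    \<le> card (horizontal_copy ?P (l div ?q) ` ?X \<union> vertical_copy ?P (k div ?q) ` ?Y)"
    using fin by (intro card_mono) auto
  also have "\<dots> \<le> card (horizontal_copy ?P (l div ?q) ` ?X) + card (vertical_copy ?P (k div ?q) ` ?Y)"
    by (rule card_Un_le)
  also have "\<dots> \<le> card ?X + card ?Y" using fin by (intro add_mono card_image_le) auto
  also have "\<dots> \<le> (cycle_load False r (k div ?q) + cycle_load True r (l mod ?q)) + (cycle_load False r (l div ?q) + cycle_load True r (k mod ?q))"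
    using b by (intro add_mono Suc.IH)
  finally show ?case by (simp add: drawing_seq_Suc num_drawing_seq)
qed

text \<open>The premises are the five pairs of non-neighbours in the cycle \<open>c0, c1, c2, c3, d\<close>.\<close>

lemma five_cycle_clique_count:
  fixes c0 c1 c2 c3 d :: bool
  assumes "\<not> (c0 \<and> c2)" "\<not> (c0 \<and> c3)" "\<not> (c1 \<and> c3)" "\<not> (c1 \<and> d)" "\<not> (c2 \<and> d)"
  shows "of_bool c0 + of_bool c1 + of_bool c2 + of_bool c3 + of_bool d \<le> (2 :: nat)"
  using assms by (cases c0; cases c1; cases c2; cases c3; cases d; simp)

lemma base_cycle_clique:
  assumes "K \<subseteq> base_cycle" "pairwise meets K"
  shows "card K \<le> 2"
proof -
  have card_K: "card K = (\<Sum>R\<in>base_cycle. of_bool (R \<in> K))"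
    using assms(1) by (intro card_subset_eq_sum) (simp_all add: base_cycle_def)
  have nm: "\<not> (R \<in> K \<and> R' \<in> K)" if "R \<noteq> R'" "\<not> meets R R'" for R R'
    using assms(2) that unfolding pairwise_def by blast
  have disj: "\<not> (Rect 0 8 2 10 \<in> K \<and> Rect 14 24 8 14 \<in> K)" "\<not> (Rect 0 8 2 10 \<in> K \<and> Rect 22 30 2 12 \<in> K)"
    "\<not> (Rect 6 16 8 14 \<in> K \<and> Rect 22 30 2 12 \<in> K)" "\<not> (Rect 6 16 8 14 \<in> K \<and> Rect 6 24 0 4 \<in> K)"
    "\<not> (Rect 14 24 8 14 \<in> K \<and> Rect 6 24 0 4 \<in> K)"
    by (rule nm; simp add: meets_iff)+
  have "card K = of_bool (Rect 0 8 2 10 \<in> K) + of_bool (Rect 6 16 8 14 \<in> K)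
      + of_bool (Rect 14 24 8 14 \<in> K) + of_bool (Rect 22 30 2 12 \<in> K) + of_bool (Rect 6 24 0 4 \<in> K)"
    unfolding card_K by (simp add: base_cycle_def del: sum_of_bool_eq)
  then show ?thesis using five_cycle_clique_count[OF disj] by simp
qed

text \<open>Without thinning the bound for crossings is \<open>2 ^ r\<close>, twice what is wanted. These crude
  bounds serve only as the starting values of \<open>a\<close> and \<open>g\<close>.\<close>

lemma cycle_clique_bounds:
  "clique_bounds (drawing_seq r) {..<num (drawing_seq r)} (cycle_rects r) (2 ^ r + 2) (2 ^ r + 1) (2 ^ r)"
proof (induction r)
  case 0
  have "card K \<le> 1"
    if K: "K \<subseteq> base_cycle" and kl: "k < 4" "l < 4" and on: "\<forall>R\<in>K. on_xi base_drawing k R \<and> on_eta base_drawing l R"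
    for K k l
  proof -
    have "card K \<le> card {R \<in> base_cycle. on_xi base_drawing k R \<and> on_eta base_drawing l R}"
      using K on by (intro card_mono) (auto simp: base_cycle_def)
    also have "\<dots> \<le> 1" using base_cycle_crossing[OF kl] by (simp add: of_bool_def split: if_splits)
    finally show ?thesis .
  qed
  moreover have "card K \<le> 3" "card K \<le> 2" if "K \<subseteq> base_cycle" "pairwise meets K" for K
    using base_cycle_clique[OF that] by auto
  moreover have "num base_drawing = 4" by (simp add: base_drawing_def)
  ultimately show ?case
    unfolding clique_bounds_def by (auto simp: drawing_seq_0)
next
  case (Suc r)
  let ?P = "drawing_seq r"
  let ?q = "num ?P"
  have P: "integral_drawing ?P" by (rule drawing_seq_integral)
  have "marker_square ?q {..<?q} = {..<?q * ?q}"
    using marker_split[OF P] by (auto simp: marker_square_def)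
  then have "clique_bounds (crossbar ?P) {..<?q * ?q} (cycle_rects (Suc r))
     (max (2 ^ r + 2) (2 * (2 ^ r + 1))) ((2 ^ r + 1) + 2 ^ r) (2 * 2 ^ r)"
    using clique_bounds_bars[OF P order_refl cycle_rects_subset Suc] by simp
  then have "clique_bounds (crossbar ?P) {..<?q * ?q} (cycle_rects (Suc r))
     (2 ^ Suc r + 2) (2 ^ Suc r + 1) (2 ^ Suc r)"
    by (rule clique_bounds_mono) auto
  then show ?case by (simp add: drawing_seq_Suc)
qed

section \<open>Concentration of the load and the lower bound\<close>

text \<open>For \<open>r = 0\<close> a horizontal marker has load \<open>1\<close> with probability \<open>1 / 2\<close>, and a vertical one has
  load \<open>0\<close>. Afterwards the load of a uniformly chosen marker is the sum of two independent loads.\<close>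

definition load_mean :: "bool \<Rightarrow> nat \<Rightarrow> real" where
  "load_mean b r = (if r = 0 then of_bool b / 2 else 2 ^ r / 4)"

definition load_variance :: "bool \<Rightarrow> nat \<Rightarrow> real" where
  "load_variance b r = (if r = 0 then of_bool b / 4 else 2 ^ r / 8)"

lemma load_moments:
  "(\<Sum>k<4 ^ 2 ^ r. cycle_load b r k - load_mean b r) = 0 \<and>
   (\<Sum>k<4 ^ 2 ^ r. (cycle_load b r k - load_mean b r)\<^sup>2) = load_variance b r * 4 ^ 2 ^ r"
proof (induction r arbitrary: b)
  case 0
  show ?case by (cases b) (simp_all add: load_mean_def load_variance_def sum_less_4 power2_eq_square)
next
  case (Suc r)
  let ?q = "4 ^ 2 ^ r :: nat"
  define f where "f k = cycle_load False r k - load_mean False r" for k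
  define h where "h k = cycle_load True r k - load_mean True r" for k
  have f: "(\<Sum>k<?q. f k) = 0" "(\<Sum>k<?q. (f k)\<^sup>2) = load_variance False r * ?q"
    and h: "(\<Sum>k<?q. h k) = 0" "(\<Sum>k<?q. (h k)\<^sup>2) = load_variance True r * ?q"
    using Suc[of False] Suc[of True] by (simp_all add: f_def h_def)
  have q: "4 ^ 2 ^ Suc r = ?q * ?q" by (simp add: mult_2 flip: power_add)
  have mean: "load_mean b (Suc r) = load_mean False r + load_mean True r"
    by (simp add: load_mean_def)
  have var: "load_variance b (Suc r) = load_variance False r + load_variance True r"
    by (simp add: load_variance_def)
  have dev: "cycle_load b (Suc r) k - load_mean b (Suc r) = f (k div ?q) + h (k mod ?q)" for k
    by (simp add: f_def h_def mean)
  have "(\<Sum>k<?q * ?q. f (k div ?q) + h (k mod ?q)) = (\<Sum>j<?q. \<Sum>t<?q. f j + h t)"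
    by (rule sum_digits)
  also have "\<dots> = 0" using f(1) h(1) by (simp add: sum.distrib flip: sum_distrib_left)
  finally have 1: "(\<Sum>k<4 ^ 2 ^ Suc r. cycle_load b (Suc r) k - load_mean b (Suc r)) = 0"
    unfolding q dev .
  have "(\<Sum>k<?q * ?q. (f (k div ?q) + h (k mod ?q))\<^sup>2) = (\<Sum>j<?q. \<Sum>t<?q. (f j + h t)\<^sup>2)"
    by (rule sum_digits[where f = "\<lambda>j t. (f j + h t)\<^sup>2"])
  also have "\<dots> = (\<Sum>j<?q. \<Sum>t<?q. (f j)\<^sup>2 + (h t)\<^sup>2 + 2 * f j * h t)"
    by (simp add: power2_sum)
  also have "\<dots> = ?q * (\<Sum>j<?q. (f j)\<^sup>2) + ?q * (\<Sum>t<?q. (h t)\<^sup>2) + (\<Sum>j<?q. 2 * f j * (\<Sum>t<?q. h t))"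
    by (simp add: sum.distrib sum_distrib_left)
  also have "\<dots> = load_variance b (Suc r) * (?q * ?q)"
    unfolding f h var by (simp add: algebra_simps)
  finally have "(\<Sum>k<4 ^ 2 ^ Suc r. (cycle_load b (Suc r) k - load_mean b (Suc r))\<^sup>2) = load_variance b (Suc r) * 4 ^ 2 ^ Suc r"
    unfolding q dev by (simp add: mult_2 power_add)
  with 1 show ?case by blast
qed

text \<open>Two light markers together have load at most \<open>(1 / 2 + 2 * \<delta>) * 2 ^ r\<close>.\<close>

definition light_markers :: "real \<Rightarrow> nat \<Rightarrow> nat set" where
  "light_markers \<delta> r = {k. k < 4 ^ 2 ^ r \<and> cycle_load False r k \<le> (1 / 4 + \<delta>) * 2 ^ r}"

text \<open>Chebyshev's inequality: the variance of the load is of order \<open>2 ^ r\<close>, the permitted deviation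
  \<open>\<delta> * 2 ^ r\<close> has a square of order \<open>4 ^ r\<close>.\<close>

lemma card_light_markers:
  assumes \<delta>: "0 < \<delta>" and r: "0 < r"
  shows "card (light_markers \<delta> r) \<ge> (1 - 1 / (8 * \<delta>\<^sup>2 * 2 ^ r)) * 4 ^ 2 ^ r"
proof -
  let ?q = "4 ^ 2 ^ r :: nat"
  \<comment> \<open>The heavy markers.\<close>
  define H where "H = {k. k < ?q \<and> \<not> cycle_load False r k \<le> (1 / 4 + \<delta>) * 2 ^ r}"
  have "card (light_markers \<delta> r \<union> H) = card (light_markers \<delta> r) + card H"
    by (intro card_Un_disjoint) (auto simp: light_markers_def H_def)
  moreover have "light_markers \<delta> r \<union> H = {..<?q}" by (auto simp: light_markers_def H_def)
  ultimately have split: "real ?q = card (light_markers \<delta> r) + card H" by (metis card_lessThan of_nat_add)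
  have "card H * (\<delta> * 2 ^ r)\<^sup>2 = (\<Sum>k\<in>H. (\<delta> * 2 ^ r)\<^sup>2)" by simp
  also have "\<dots> \<le> (\<Sum>k\<in>H. (cycle_load False r k - load_mean False r)\<^sup>2)"
    using \<delta> r by (intro sum_mono power_mono) (auto simp: H_def load_mean_def algebra_simps)
  also have "\<dots> \<le> (\<Sum>k<?q. (cycle_load False r k - load_mean False r)\<^sup>2)"
    by (intro sum_mono2) (auto simp: H_def)
  also have "\<dots> = 2 ^ r / 8 * ?q"
    using load_moments[of False r] r by (simp add: load_variance_def)
  finally have "card H * (\<delta>\<^sup>2 * 2 ^ r * 2 ^ r) \<le> 2 ^ r / 8 * ?q"
    by (simp add: power_mult_distrib power2_eq_square mult_ac)
  then have "card H * (\<delta>\<^sup>2 * 2 ^ r) * 2 ^ r \<le> (?q / 8) * 2 ^ r"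
    by (simp add: mult_ac)
  then have "card H * (\<delta>\<^sup>2 * 2 ^ r) \<le> ?q / 8"
    by (rule mult_right_le_imp_le) simp
  then have "card H \<le> ?q / (8 * \<delta>\<^sup>2 * 2 ^ r)"
    using \<delta> by (simp add: field_simps)
  then show ?thesis using split by (simp add: algebra_simps)
qed

lemma light_clique_bounds:
  assumes r: "0 < r"
  shows "clique_bounds (drawing_seq r) (light_markers \<delta> r) (cycle_rects r)
    (2 ^ r + 2) (2 ^ r + 1) ((1 / 2 + 2 * \<delta>) * 2 ^ r)"
proof -
  have sub: "light_markers \<delta> r \<subseteq> {..<num (drawing_seq r)}"
    by (auto simp: light_markers_def num_drawing_seq)
  have same: "cycle_load True r k = cycle_load False r k" for k
    using r by (cases r) simp_all
  have "real (card K) \<le> (1 / 2 + 2 * \<delta>) * 2 ^ r"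
    if K: "K \<subseteq> cycle_rects r" and kl: "k \<in> light_markers \<delta> r" "l \<in> light_markers \<delta> r"
      and on: "\<forall>R\<in>K. on_xi (drawing_seq r) k R \<and> on_eta (drawing_seq r) l R" for K k l
  proof -
    have "card K \<le> card {R \<in> cycle_rects r. on_xi (drawing_seq r) k R \<and> on_eta (drawing_seq r) l R}"
      using K on cycle_rects_subset[of r] finite_rects[OF drawing_seq_integral, of r]
      by (intro card_mono) (auto intro: finite_subset)
    also have "\<dots> \<le> cycle_load False r k + cycle_load True r l"
      using kl sub by (intro card_crossing_le_load) auto
    finally have "real (card K) \<le> real (cycle_load False r k) + real (cycle_load False r l)"
      unfolding same by linarith
    also have "\<dots> \<le> (1 / 4 + \<delta>) * 2 ^ r + (1 / 4 + \<delta>) * 2 ^ r"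
      using kl by (intro add_mono) (auto simp: light_markers_def)
    finally show ?thesis by (simp add: algebra_simps)
  qed
  then show ?thesis
    using clique_bounds_mono[OF cycle_clique_bounds[of r] sub order_refl order_refl order_refl]
    unfolding clique_bounds_def by blast
qed

definition light_density :: "real \<Rightarrow> nat \<Rightarrow> real" where
  "light_density \<delta> r = card (light_markers \<delta> r) / 4 ^ 2 ^ r"

lemma light_density_tendsto:
  assumes "0 < \<delta>"
  shows "light_density \<delta> \<longlonglongrightarrow> 1"
proof (rule tendsto_sandwich)
  show "\<forall>\<^sub>F r in sequentially. 1 - 1 / (8 * \<delta>\<^sup>2) * (1 / 2) ^ r \<le> light_density \<delta> r"
    using eventually_gt_at_top[of 0]
  proof eventually_elim
    case (elim r)
    then show ?case
      using card_light_markers[OF assms elim] by (simp add: light_density_def field_simps)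
  qed
  show "\<forall>\<^sub>F r in sequentially. light_density \<delta> r \<le> 1"
  proof (intro always_eventually allI)
    fix r
    have "card (light_markers \<delta> r) \<le> card {..<4 ^ 2 ^ r :: nat}"
      by (intro card_mono) (auto simp: light_markers_def)
    then have "real (card (light_markers \<delta> r)) \<le> real (4 ^ 2 ^ r)"
      unfolding card_lessThan of_nat_le_iff .
    then show "light_density \<delta> r \<le> 1" by (simp add: light_density_def)
  qed
  have "(\<lambda>r. 1 - 1 / (8 * \<delta>\<^sup>2) * (1 / 2) ^ r) \<longlonglongrightarrow> 1 - 1 / (8 * \<delta>\<^sup>2) * 0"
    by (intro tendsto_intros LIMSEQ_power_zero) simp
  then show "(\<lambda>r. 1 - 1 / (8 * \<delta>\<^sup>2) * (1 / 2) ^ r) \<longlonglongrightarrow> 1" by simp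
qed simp

text \<open>Starting from the light markers at level \<open>r\<close>, \<open>d\<close> thinned steps lead to level \<open>r + d\<close>. The indices
  added on the way are composed of \<open>1 + 2 + \<dots> + 2 ^ (d - 1)\<close> light markers of level \<open>r\<close>, hence the
  exponent; the term \<open>4 / 2 ^ d\<close> is what is left of the initial clique bounds.\<close>

lemma alpha_star_lower_bound:
  assumes r: "0 < r" and \<delta>: "0 < \<delta>"
  shows "light_density \<delta> r ^ (2 ^ d - 1) * (5 / 4 / (4 / 2 ^ d + 1 / 2 + 2 * \<delta>))
    \<le> alpha_star (rect_family (r + d)) / 4 ^ 2 ^ (r + d)"
proof -
  let ?p = "light_density \<delta> r"
  let ?q = "4 ^ 2 ^ r :: real"
  let ?c = "(1 / 2 + 2 * \<delta>) * 2 ^ r"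
  let ?D = "4 + 2 ^ d * (1 / 2 + 2 * \<delta>)"
  have sub: "light_markers \<delta> r \<subseteq> {..<num (drawing_seq r)}"
    by (auto simp: light_markers_def num_drawing_seq)
  obtain G A where A: "A \<subseteq> rects (drawing_seq (r + d))"
    and card_A: "card A = 2 ^ d * card (light_markers \<delta> r) ^ (2 ^ d - 1) * card (cycle_rects r)"
    and b: "clique_bounds (drawing_seq (r + d)) G A
      (max (2 ^ r + 2) (2 * (2 ^ r + 1) + 2 ^ d * ?c)) (2 ^ r + 1 + (2 ^ d - 1) * ?c) (2 ^ d * ?c)"
    using iterated_thinning[OF sub cycle_rects_subset light_clique_bounds[OF r], of d] \<delta> by auto
  have two: "(2::real) \<le> 2 ^ r"
    using power_increasing[of 1 r "2::real"] r by simp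
  have a: "real (card K) \<le> ?D * 2 ^ r" if "K \<subseteq> A" "pairwise meets K" for K
  proof -
    have "real (card K) \<le> max (2 ^ r + 2) (2 * (2 ^ r + 1) + 2 ^ d * ?c)"
      using b that unfolding clique_bounds_def by blast
    also have "\<dots> \<le> 4 * 2 ^ r + 2 ^ d * ?c" using two \<delta> by auto
    finally show ?thesis by (simp add: algebra_simps)
  qed
  have D: "0 < ?D" using \<delta> by (simp add: add_pos_pos)
  obtain X where X: "finite X" "\<forall>R\<in>rect_family (r + d). region R \<inter> X \<noteq> {}"
    using small_piercing_set by blast
  have fin: "finite (rect_family (r + d))"
    unfolding rect_family_def by (rule finite_rects[OF drawing_seq_integral])
  have "card A / (?D * 2 ^ r) \<le> alpha_star (rect_family (r + d))"
    using A a D by (intro alpha_star_ge[OF fin X]) (simp_all add: rect_family_def)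
  moreover have "real (card A) = 2 ^ d * ?p ^ (2 ^ d - 1) * (5 / 4 * 2 ^ r * 4 ^ 2 ^ (r + d))"
  proof -
    have q: "?q ^ (2 ^ d - 1) * ?q = 4 ^ 2 ^ (r + d)"
    proof -
      have "?q ^ (2 ^ d - 1) * ?q = ?q ^ (2 ^ d)"
        by (metis power_minus_mult zero_less_numeral zero_less_power)
      then show ?thesis by (simp add: power_add flip: power_mult)
    qed
    have "real (4 * card (cycle_rects r)) = real (5 * 2 ^ r * 4 ^ 2 ^ r)"
      unfolding card_cycle_rects ..
    then have 1: "real (card (cycle_rects r)) = 5 / 4 * 2 ^ r * ?q" by simp
    have 2: "real (card (light_markers \<delta> r)) = ?p * ?q" by (simp add: light_density_def)
    have "real (card A) = 2 ^ d * ?p ^ (2 ^ d - 1) * (5 / 4 * 2 ^ r * (?q ^ (2 ^ d - 1) * ?q))"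
      unfolding card_A of_nat_mult of_nat_power 1 2 by (simp add: power_mult_distrib)
    then show ?thesis unfolding q .
  qed
  ultimately have "2 ^ d * ?p ^ (2 ^ d - 1) * (5 / 4 * 2 ^ r * 4 ^ 2 ^ (r + d)) / (?D * 2 ^ r)
     \<le> alpha_star (rect_family (r + d))"
    by simp
  moreover have "x * (5 / 4 * u * Q) / (D * u) = x * (5 / 4) / D * Q" if "u \<noteq> 0" for x u Q D :: real
    using that by simp
  ultimately have "2 ^ d * ?p ^ (2 ^ d - 1) * (5 / 4) / ?D * 4 ^ 2 ^ (r + d) \<le> alpha_star (rect_family (r + d))"
    by (metis power_not_zero zero_neq_numeral)
  then have "2 ^ d * ?p ^ (2 ^ d - 1) * (5 / 4) / ?D \<le> alpha_star (rect_family (r + d)) / 4 ^ 2 ^ (r + d)"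
    by (simp add: pos_le_divide_eq)
  also have "2 ^ d * ?p ^ (2 ^ d - 1) * (5 / 4) / ?D = ?p ^ (2 ^ d - 1) * (5 / 4 / (?D / 2 ^ d))"
    by (simp add: field_simps)
  also have "?D / 2 ^ d = 4 / 2 ^ d + 1 / 2 + 2 * \<delta>" by (simp add: field_simps)
  finally show ?thesis .
qed

text \<open>The order of the limits matters. First \<open>d\<close> is fixed so large, and \<open>\<delta>\<close> so small, that the second
  factor in the lower bound exceeds \<open>e\<close>; then \<open>r\<close> grows and the first factor tends to \<open>1\<close>.\<close>

lemma alpha_star_eventually_large:
  assumes "e < 5 / 2"
  shows "\<forall>\<^sub>F r in sequentially. e < alpha_star (rect_family r) / 4 ^ 2 ^ r"
proof -
  have "(\<lambda>d. 5 / 4 / (6 * (1 / 2) ^ d + 1 / 2)) \<longlonglongrightarrow> 5 / 4 / (6 * 0 + 1 / 2 :: real)"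
    by (intro tendsto_intros LIMSEQ_power_zero) simp_all
  moreover have "e < 5 / 4 / (6 * 0 + 1 / 2)" using assms by simp
  ultimately have "\<forall>\<^sub>F d in sequentially. e < 5 / 4 / (6 * (1 / 2) ^ d + 1 / 2)"
    by (rule order_tendstoD(1))
  then obtain d where d: "e < 5 / 4 / (6 * (1 / 2) ^ d + 1 / 2)"
    by (auto simp: eventually_sequentially)
  \<comment> \<open>Both error terms in the denominator are now multiples of \<open>1 / 2 ^ d\<close>, with sum \<open>6 / 2 ^ d\<close>.\<close>
  define \<delta> :: real where "\<delta> = 1 / 2 ^ d"
  define C where "C = 5 / 4 / (4 / 2 ^ d + 1 / 2 + 2 * \<delta>)"
  have \<delta>: "0 < \<delta>" by (simp add: \<delta>_def)
  have "e < C" using d by (simp add: C_def \<delta>_def power_divide algebra_simps)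
  have "(\<lambda>r. light_density \<delta> r ^ (2 ^ d - 1) * C) \<longlonglongrightarrow> 1 ^ (2 ^ d - 1) * C"
    by (intro tendsto_intros light_density_tendsto \<delta>)
  then have "\<forall>\<^sub>F r in sequentially. e < light_density \<delta> r ^ (2 ^ d - 1) * C"
    using \<open>e < C\<close> by (intro order_tendstoD(1)) simp_all
  with eventually_gt_at_top[of 0]
  have "\<forall>\<^sub>F r in sequentially. e < alpha_star (rect_family (r + d)) / 4 ^ 2 ^ (r + d)"
  proof eventually_elim
    case (elim r)
    then show ?case using alpha_star_lower_bound[OF elim(1) \<delta>, of d] by (simp add: C_def)
  qed
  then show ?thesis
    using eventually_sequentially_seg[of "\<lambda>r. e < alpha_star (rect_family r) / 4 ^ 2 ^ r" d] by simp
qed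

section \<open>The limits\<close>

theorem theorem3:
  shows "(\<lambda>r. alpha_star (rect_family r) / real (packing_number (rect_family r)))
           \<longlonglongrightarrow> 5 / 2
       \<and> (\<lambda>r. real (piercing_number (rect_family r)) / real (packing_number (rect_family r)))
           \<longlonglongrightarrow> 5 / 2"
proof -
  have nu: "real (packing_number (rect_family r)) = 4 ^ 2 ^ r" for r
    by (simp add: packing_number_rect_family)
  have le: "alpha_star (rect_family r) \<le> piercing_number (rect_family r)" for r
  proof -
    obtain X where "finite X" "\<forall>R\<in>rect_family r. region R \<inter> X \<noteq> {}"
      using small_piercing_set by blast
    then show ?thesis
      by (intro alpha_star_le_piercing)
         (simp_all add: rect_family_def finite_rects[OF drawing_seq_integral])
  qed
  have tau: "piercing_number (rect_family r) / 4 ^ 2 ^ r \<le> (5 / 2 :: real)" for r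
  proof -
    have "real (2 * piercing_number (rect_family r)) \<le> real (5 * 4 ^ 2 ^ r)"
      using piercing_number_le[of r] unfolding of_nat_le_iff .
    then show ?thesis by (simp add: field_simps)
  qed
  have alpha: "alpha_star (rect_family r) / 4 ^ 2 ^ r \<le> piercing_number (rect_family r) / 4 ^ 2 ^ r" for r
    using le by (simp add: divide_right_mono)
  have 1: "(\<lambda>r. alpha_star (rect_family r) / 4 ^ 2 ^ r) \<longlonglongrightarrow> 5 / 2"
  proof (rule order_tendstoI)
    fix e :: real assume "5 / 2 < e"
    then show "\<forall>\<^sub>F r in sequentially. alpha_star (rect_family r) / 4 ^ 2 ^ r < e"
      using alpha tau by (intro always_eventually allI) (meson le_less_trans)
  qed (rule alpha_star_eventually_large)
  have 2: "(\<lambda>r. piercing_number (rect_family r) / 4 ^ 2 ^ r :: real) \<longlonglongrightarrow> 5 / 2"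
    by (rule tendsto_sandwich[OF _ _ 1 tendsto_const]) (use alpha tau in simp_all)
  show ?thesis unfolding nu using 1 2 by blast
qed

end
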